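(* Let $M=(M,g)$ be a 5-dimensional Riemannian manifold. (a) If $M$ is Einstein, then the following curvature identity holds on $M$ (for all $i,j$): $$2\tau\overline{R}_{ij}+4\check{R}_{ij}+4\hat{R}_{ij}-8\mathring{R}_{ij} = \Big(\frac{\tau}{5}\|R\|^2 + \frac{\tau^3}{25}\Big)g_{ij}.$$ (b) If $M$ is super-Einstein, then the following curvature identity holds on $M$ (for all $i,j$): $$4\mathring{R}_{ij} - 2\hat{R}_{ij} =\Big(\frac{9}{50}\tau\|R\|^2 -\frac{\tau^3}{50}\Big)g_{ij}.$$
   Context: Let $(M,g)$ be an $m$-dimensional Riemannian manifold with Levi-Civita connection $\nabla$. The curvature tensor is $R(X,Y)Z=[\nabla_X,\nabla_Y]Z-\nabla_{[X,Y]}Z$. The Ricci tensor is $\rho(X,Y)=\operatorname{Tr}(Z\mapsto R(Z,X)Y)$ and the scalar curvature is $\tau=\operatorname{Tr}\rho$. All components are taken with respect to a local orthonormal frame $\{e_i\}$, with summation over repeated indices, and $g_{ij}=g(e_i,e_j)=\delta_{ij}$. The components of the curvature tensor are $R_{ijkl}=g(R(e_i,e_j)e_k,e_l)$, so that $R_{1221}=k$ on a space of constant sectional curvature $k$ and $\rho_{ij}=R_{aija}$. Set $\|R\|^2=R_{abcd}R_{abcd}$ and $$\overline{R}_{ij}=R_{iabc}R_{jabc},\quad \check{R}_{ij}=R_{iuvj}R_{abcu}R_{abcv},\quad \hat{R}_{ij}=R_{ibcd}R_{jbuv}R_{cduv},\quad \mathring{R}_{ij}=R_{ibcd}R_{jucv}R_{budv}.$$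 $M$ is Einstein if $\rho=\frac{\tau}{m}g$. An Einstein manifold $M$ is super-Einstein if $\overline{R}_{ij}=\frac{\|R\|^2}{m}g_{ij}$ with $\|R\|^2$ constant. *)

theory Defs
  imports "HOL-Analysis.Analysis" "HOL-Library.Function_Algebras"
begin

section \<open>Preliminaries\<close>

text \<open>
  Tangent vectors will be real-valued functionals on functions. The pointwise vector space
  structure makes the library notions \<^const>\<open>span\<close>, \<^const>\<open>independent\<close> and
  \<^const>\<open>representation\<close> available for them.
\<close>

instantiation "fun" :: (type, real_vector) real_vector
begin

definition scaleR_fun :: "real \<Rightarrow> ('a \<Rightarrow> 'b) \<Rightarrow> 'a \<Rightarrow> 'b"
  where "scaleR_fun c f = (\<lambda>x. c *\<^sub>R f x)"

instance
  by standard (simp_all add: scaleR_fun_def plus_fun_def fun_eq_iff scaleR_add_right scaleR_add_left)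

end

text \<open>
  \<open>Ck_on k S f\<close>, for an open subset \<open>S\<close> of a finite-dimensional space: all iterated directional
  derivatives of \<open>f\<close> of order at most \<open>k\<close> exist and are continuous on \<open>S\<close>.
\<close>

primrec Ck_on ::
  "nat \<Rightarrow> 'a::euclidean_space set \<Rightarrow> ('a \<Rightarrow> 'b::real_normed_vector) \<Rightarrow> bool" where
  "Ck_on 0 S f \<longleftrightarrow> continuous_on S f"
| "Ck_on (Suc k) S f \<longleftrightarrow>
     (\<forall>x\<in>S. f differentiable (at x)) \<and> (\<forall>v. Ck_on k S (\<lambda>x. frechet_derivative f (at x) v))"

definition smooth_on ::
  "'a::euclidean_space set \<Rightarrow> ('a \<Rightarrow> 'b::real_normed_vector) \<Rightarrow> bool" where
  "smooth_on S f \<longleftrightarrow> (\<forall>k. Ck_on k S f)"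

text \<open>
  Trace of a linear endomorphism of a finite-dimensional subspace \<open>V\<close>: the sum of its diagonal
  matrix entries in a basis.
\<close>

definition trace_on :: "'v::real_vector set \<Rightarrow> ('v \<Rightarrow> 'v) \<Rightarrow> real" where
  "trace_on V L =
     (let B = (SOME B. independent B \<and> span B = V) in \<Sum>b\<in>B. representation B (L b) b)"


section \<open>Smooth manifolds\<close>

text \<open>A chart is a pair of its domain and its coordinate map.\<close>

type_synonym ('a, 'n) chart = "'a set \<times> ('a \<Rightarrow> real^'n)"

text \<open>Functionals on functions; the tangent spaces consist of such functionals.\<close>

type_synonym 'a tvec = "('a \<Rightarrow> real) \<Rightarrow> real"

locale smooth_manifold =
  fixes M :: "'a topology"
    and A :: "('a, 'n::finite) chart set"
  assumes Hausdorff: "Hausdorff_space M"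
    and second_countable: "second_countable M"
    and charts: "\<And>U \<phi>. (U, \<phi>) \<in> A \<Longrightarrow>
          openin M U \<and> open (\<phi> ` U) \<and> homeomorphic_map (subtopology M U) (top_of_set (\<phi> ` U)) \<phi>"
    and charts_cover: "(\<Union>(U, \<phi>)\<in>A. U) = topspace M"
    and charts_compatible: "\<And>U \<phi> V \<psi>. (U, \<phi>) \<in> A \<Longrightarrow> (V, \<psi>) \<in> A \<Longrightarrow>
          smooth_on (\<phi> ` (U \<inter> V)) (\<psi> \<circ> inv_into U \<phi>)"
begin

text \<open>
  Functions and vector fields on an open set \<open>W\<close> are represented by total functions whose values
  outside \<open>W\<close> are irrelevant.
\<close>

definition smooth_fun :: "'a set \<Rightarrow> ('a \<Rightarrow> real) \<Rightarrow> bool" where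
  "smooth_fun W f \<longleftrightarrow>
     openin M W \<and> (\<forall>(U, \<phi>)\<in>A. smooth_on (\<phi> ` (W \<inter> U)) (f \<circ> inv_into U \<phi>))"

definition smooth_near :: "'a \<Rightarrow> ('a \<Rightarrow> real) \<Rightarrow> bool" where
  "smooth_near p f \<longleftrightarrow> (\<exists>W. p \<in> W \<and> smooth_fun W f)"

text \<open>
  Tangent vectors at \<open>p\<close> are the derivations on germs at \<open>p\<close> of smooth functions. The last
  condition fixes the irrelevant values on functions that are not smooth near \<open>p\<close>, so
  that equality of functionals is equality of derivations.
\<close>

definition tangent_space :: "'a \<Rightarrow> 'a tvec set" where
  "tangent_space p = {v.
     (\<forall>f h. smooth_near p f \<and> smooth_near p h \<longrightarrow>
        v (\<lambda>q. f q + h q) = v f + v h \<and>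
        v (\<lambda>q. f q * h q) = v f * h p + f p * v h) \<and>
     (\<forall>c f. smooth_near p f \<longrightarrow> v (\<lambda>q. c * f q) = c * v f) \<and>
     (\<forall>f h W. smooth_near p f \<and> smooth_near p h \<and> openin M W \<and> p \<in> W \<and> (\<forall>q\<in>W. f q = h q) \<longrightarrow>
        v f = v h) \<and>
     (\<forall>f. \<not> smooth_near p f \<longrightarrow> v f = 0)}"

definition vector_field :: "'a set \<Rightarrow> ('a \<Rightarrow> 'a tvec) \<Rightarrow> bool" where
  "vector_field U X \<longleftrightarrow>
     openin M U \<and> (\<forall>p\<in>U. X p \<in> tangent_space p) \<and>
     (\<forall>W f. W \<subseteq> U \<and> smooth_fun W f \<longrightarrow> smooth_fun W (\<lambda>p. X p f))"

definition lie_bracket :: "('a \<Rightarrow> 'a tvec) \<Rightarrow> ('a \<Rightarrow> 'a tvec) \<Rightarrow> 'a \<Rightarrow> 'a tvec" where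
  "lie_bracket X Y p =
     (\<lambda>f. if smooth_near p f then X p (\<lambda>q. Y q f) - Y p (\<lambda>q. X q f) else 0)"

end


section \<open>Riemannian metrics\<close>

locale riemannian_manifold = smooth_manifold M A
  for M :: "'a topology" and A :: "('a, 'n::finite) chart set" +
  fixes g :: "'a \<Rightarrow> 'a tvec \<Rightarrow> 'a tvec \<Rightarrow> real"
  assumes metric_linear: "\<And>p u v w a b. p \<in> topspace M \<Longrightarrow>
          u \<in> tangent_space p \<Longrightarrow> v \<in> tangent_space p \<Longrightarrow> w \<in> tangent_space p \<Longrightarrow>
          g p (a *\<^sub>R u + b *\<^sub>R v) w = a * g p u w + b * g p v w"
    and metric_sym: "\<And>p u v. p \<in> topspace M \<Longrightarrow>
          u \<in> tangent_space p \<Longrightarrow> v \<in> tangent_space p \<Longrightarrow> g p u v = g p v u"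
    and metric_pos: "\<And>p v. p \<in> topspace M \<Longrightarrow>
          v \<in> tangent_space p \<Longrightarrow> v \<noteq> 0 \<Longrightarrow> g p v v > 0"
    and metric_smooth: "\<And>U X Y. vector_field U X \<Longrightarrow> vector_field U Y \<Longrightarrow>
          smooth_fun U (\<lambda>p. g p (X p) (Y p))"
begin

definition orthonormal_basis :: "'a \<Rightarrow> ('n \<Rightarrow> 'a tvec) \<Rightarrow> bool" where
  "orthonormal_basis p e \<longleftrightarrow>
     span (range e) = tangent_space p \<and> (\<forall>i j. g p (e i) (e j) = (if i = j then 1 else 0))"

definition orthonormal_frame :: "'a set \<Rightarrow> ('n \<Rightarrow> 'a \<Rightarrow> 'a tvec) \<Rightarrow> bool" where
  "orthonormal_frame U E \<longleftrightarrow>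
     openin M U \<and> (\<forall>i. vector_field U (E i)) \<and> (\<forall>p\<in>U. orthonormal_basis p (\<lambda>i. E i p))"

text \<open>Trace with respect to the metric of a bilinear form on the tangent space at \<open>p\<close>.\<close>

definition metric_trace :: "'a \<Rightarrow> ('a tvec \<Rightarrow> 'a tvec \<Rightarrow> real) \<Rightarrow> real" where
  "metric_trace p h = (let e = (SOME e. orthonormal_basis p e) in \<Sum>a\<in>UNIV. h (e a) (e a))"

end


section \<open>The Levi-Civita connection and its curvature\<close>

text \<open>
  \<open>nabla p v Y\<close> is the covariant derivative at \<open>p\<close> in the direction of the tangent vector \<open>v\<close> of a
  vector field \<open>Y\<close> defined near \<open>p\<close>; for fields \<open>X\<close> and \<open>Y\<close> one has
  \<open>(nabla_X Y)(p) = nabla p (X p) Y\<close>. Tensoriality in \<open>X\<close> is thus built in, and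
  \<open>conn_local\<close> says that only the germ of \<open>Y\<close> at \<open>p\<close> matters. The last two assumptions,
  vanishing torsion and compatibility with the metric, single out the Levi-Civita connection.
\<close>

locale levi_civita_manifold = riemannian_manifold M A g
  for M :: "'a topology" and A :: "('a, 'n::finite) chart set"
    and g :: "'a \<Rightarrow> 'a tvec \<Rightarrow> 'a tvec \<Rightarrow> real" +
  fixes nabla :: "'a \<Rightarrow> 'a tvec \<Rightarrow> ('a \<Rightarrow> 'a tvec) \<Rightarrow> 'a tvec"
  assumes conn_smooth: "\<And>U X Y. vector_field U X \<Longrightarrow> vector_field U Y \<Longrightarrow>
          vector_field U (\<lambda>p. nabla p (X p) Y)"
    and conn_tangent: "\<And>U Y p v. vector_field U Y \<Longrightarrow> p \<in> U \<Longrightarrow> v \<in> tangent_space p \<Longrightarrow>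
          nabla p v Y \<in> tangent_space p"
    and conn_local: "\<And>U Y Z p v. vector_field U Y \<Longrightarrow> vector_field U Z \<Longrightarrow>
          p \<in> U \<Longrightarrow> v \<in> tangent_space p \<Longrightarrow> (\<And>q. q \<in> U \<Longrightarrow> Y q = Z q) \<Longrightarrow>
          nabla p v Y = nabla p v Z"
    and conn_linear: "\<And>U Y p v w a b. vector_field U Y \<Longrightarrow>
          p \<in> U \<Longrightarrow> v \<in> tangent_space p \<Longrightarrow> w \<in> tangent_space p \<Longrightarrow>
          nabla p (a *\<^sub>R v + b *\<^sub>R w) Y = a *\<^sub>R nabla p v Y + b *\<^sub>R nabla p w Y"
    and conn_add: "\<And>U Y Z p v. vector_field U Y \<Longrightarrow> vector_field U Z \<Longrightarrow>
          p \<in> U \<Longrightarrow> v \<in> tangent_space p \<Longrightarrow>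
          nabla p v (\<lambda>q. Y q + Z q) = nabla p v Y + nabla p v Z"
    and conn_Leibniz: "\<And>U f Y p v. smooth_fun U f \<Longrightarrow> vector_field U Y \<Longrightarrow>
          p \<in> U \<Longrightarrow> v \<in> tangent_space p \<Longrightarrow>
          nabla p v (\<lambda>q. f q *\<^sub>R Y q) = v f *\<^sub>R Y p + f p *\<^sub>R nabla p v Y"
    and torsion_free: "\<And>U X Y p. vector_field U X \<Longrightarrow> vector_field U Y \<Longrightarrow> p \<in> U \<Longrightarrow>
          nabla p (X p) Y - nabla p (Y p) X = lie_bracket X Y p"
    and metric_compatible: "\<And>U Y Z p v. vector_field U Y \<Longrightarrow> vector_field U Z \<Longrightarrow>
          p \<in> U \<Longrightarrow> v \<in> tangent_space p \<Longrightarrow>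
          v (\<lambda>q. g q (Y q) (Z q)) = g p (nabla p v Y) (Z p) + g p (Y p) (nabla p v Z)"
begin

definition cov :: "('a \<Rightarrow> 'a tvec) \<Rightarrow> ('a \<Rightarrow> 'a tvec) \<Rightarrow> 'a \<Rightarrow> 'a tvec" where
  "cov X Y = (\<lambda>p. nabla p (X p) Y)"

definition curvature ::
  "('a \<Rightarrow> 'a tvec) \<Rightarrow> ('a \<Rightarrow> 'a tvec) \<Rightarrow> ('a \<Rightarrow> 'a tvec) \<Rightarrow> 'a \<Rightarrow> 'a tvec" where
  "curvature X Y Z = (\<lambda>p. cov X (cov Y Z) p - cov Y (cov X Z) p - cov (lie_bracket X Y) Z p)"

text \<open>
  The curvature tensor at \<open>p\<close>, applied to tangent vectors. It is the value of \<^const>\<open>curvature\<close>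
  on any extension of these vectors to vector fields near \<open>p\<close>.
\<close>

definition curv :: "'a \<Rightarrow> 'a tvec \<Rightarrow> 'a tvec \<Rightarrow> 'a tvec \<Rightarrow> 'a tvec" where
  "curv p x y z =
     (THE w. \<exists>U X Y Z. p \<in> U \<and> vector_field U X \<and> vector_field U Y \<and> vector_field U Z \<and>
        X p = x \<and> Y p = y \<and> Z p = z \<and> w = curvature X Y Z p)"

definition ricci :: "'a \<Rightarrow> 'a tvec \<Rightarrow> 'a tvec \<Rightarrow> real" where
  "ricci p x y = trace_on (tangent_space p) (\<lambda>z. curv p z x y)"

definition scal :: "'a \<Rightarrow> real" where
  "scal p = metric_trace p (ricci p)"

text \<open>
  Components with respect to a family \<open>E\<close> of vector fields, evaluated at \<open>p\<close>. They are only
  used for local orthonormal frames.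
\<close>

definition Rc :: "('n \<Rightarrow> 'a \<Rightarrow> 'a tvec) \<Rightarrow> 'a \<Rightarrow> 'n \<Rightarrow> 'n \<Rightarrow> 'n \<Rightarrow> 'n \<Rightarrow> real" where
  "Rc E p i j k l = g p (curv p (E i p) (E j p) (E k p)) (E l p)"

definition R_norm_sq :: "('n \<Rightarrow> 'a \<Rightarrow> 'a tvec) \<Rightarrow> 'a \<Rightarrow> real" where
  "R_norm_sq E p =
     (\<Sum>a\<in>UNIV. \<Sum>b\<in>UNIV. \<Sum>c\<in>UNIV. \<Sum>d\<in>UNIV. Rc E p a b c d * Rc E p a b c d)"

definition R_bar :: "('n \<Rightarrow> 'a \<Rightarrow> 'a tvec) \<Rightarrow> 'a \<Rightarrow> 'n \<Rightarrow> 'n \<Rightarrow> real" where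
  "R_bar E p i j = (\<Sum>a\<in>UNIV. \<Sum>b\<in>UNIV. \<Sum>c\<in>UNIV. Rc E p i a b c * Rc E p j a b c)"

definition R_check :: "('n \<Rightarrow> 'a \<Rightarrow> 'a tvec) \<Rightarrow> 'a \<Rightarrow> 'n \<Rightarrow> 'n \<Rightarrow> real" where
  "R_check E p i j =
     (\<Sum>u\<in>UNIV. \<Sum>v\<in>UNIV. \<Sum>a\<in>UNIV. \<Sum>b\<in>UNIV. \<Sum>c\<in>UNIV.
        Rc E p i u v j * Rc E p a b c u * Rc E p a b c v)"

definition R_hat :: "('n \<Rightarrow> 'a \<Rightarrow> 'a tvec) \<Rightarrow> 'a \<Rightarrow> 'n \<Rightarrow> 'n \<Rightarrow> real" where
  "R_hat E p i j =
     (\<Sum>b\<in>UNIV. \<Sum>c\<in>UNIV. \<Sum>d\<in>UNIV. \<Sum>u\<in>UNIV. \<Sum>v\<in>UNIV.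
        Rc E p i b c d * Rc E p j b u v * Rc E p c d u v)"

definition R_ring :: "('n \<Rightarrow> 'a \<Rightarrow> 'a tvec) \<Rightarrow> 'a \<Rightarrow> 'n \<Rightarrow> 'n \<Rightarrow> real" where
  "R_ring E p i j =
     (\<Sum>b\<in>UNIV. \<Sum>c\<in>UNIV. \<Sum>d\<in>UNIV. \<Sum>u\<in>UNIV. \<Sum>v\<in>UNIV.
        Rc E p i b c d * Rc E p j u c v * Rc E p b u d v)"

definition einstein :: bool where
  "einstein \<longleftrightarrow> (\<forall>p\<in>topspace M. \<forall>x\<in>tangent_space p. \<forall>y\<in>tangent_space p.
     ricci p x y = scal p / real CARD('n) * g p x y)"

definition super_einstein :: bool where
  "super_einstein \<longleftrightarrow> einstein \<and>
     (\<forall>U E p i j. orthonormal_frame U E \<and> p \<in> U \<longrightarrow>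
        R_bar E p i j = R_norm_sq E p / real CARD('n) * g p (E i p) (E j p)) \<and>
     (\<exists>c. \<forall>U E p. orthonormal_frame U E \<and> p \<in> U \<longrightarrow> R_norm_sq E p = c)"

end

end

theory Submission
  imports Defs
begin

text \<open>
  In dimension 5 a 6-form vanishes. Regard \<open>R\<^sub>p\<^sub>q\<close>, \<open>R\<^sub>r\<^sub>s\<close> and
  \<open>R\<^sub>t\<^sub>i\<close> as 2-forms in the last two indices of the curvature tensor, evaluate their wedge
  product on the frame vectors with indices \<open>p, q, r, s, t, j\<close>, and sum over \<open>p, q, r, s, t\<close>.
  The symmetries of \<open>R\<close> leave five kinds of terms, which are distinguished by the pair of frame
  vectors inserted into \<open>R\<^sub>t\<^sub>i\<close>. The Einstein condition evaluates all contractions in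
  them, and (a) says that their sum is zero. For super-Einstein manifolds the tensors
  \<open>R_bar\<close> and \<open>R_check\<close> in (a) are multiples of the metric, which gives (b).
\<close>

section \<open>Forms of degree six\<close>

text \<open>The contracted 6-form is the Ricci-type contraction of the third exterior power of the
  curvature: putting \<open>i = j\<close> and summing gives, up to a factor, the Gauss-Bonnet
  integrand of dimension six, which makes sense in every dimension and vanishes below six. Two
  obstacles shape the rest. First, the terms in which \<open>K t i\<close> receives one index from
  each of the other two factors do not produce \<open>ring\<close> but a cubic contraction with
  other slots in one factor, here \<open>ring_flip\<close>. The first Bianchi identity turns it into
  \<open>hat / 4 - ring\<close>. With coefficient 8 it adds 2 to the coefficient 2 of
  \<open>hat\<close> coming from elsewhere, hence the 4 and the -8 in (a). Secondly,
  \<open>curv\<close> is a definite description over all extensions of three vectors to fields, so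
  it has a value only once tensoriality is known. The statement supplies an orthonormal frame on a
  neighbourhood of the point. Expanding fields in this frame gives tensoriality, and constant
  coefficients give extensions, so that cut-off functions never enter.\<close>

definition wedge2 :: "('n \<Rightarrow> 'n \<Rightarrow> real) \<Rightarrow> ('n \<Rightarrow> 'n \<Rightarrow> real) \<Rightarrow> 'n \<Rightarrow> 'n \<Rightarrow> 'n \<Rightarrow> 'n \<Rightarrow> real" where
  "wedge2 f g w x y z = f w x * g y z - f w y * g x z + f w z * g x y
     + f x y * g w z - f x z * g w y + f y z * g w x"

text \<open>Expansion along \<open>h\<close>: one term for each of the 15 pairs of slots that
  \<open>h\<close> can receive, with the sign of the shuffle, so no factorials occur. This form
  allows the terms to be sorted later by the pair in \<open>h\<close>.\<close>

definition wedge3 :: "('n \<Rightarrow> 'n \<Rightarrow> real) \<Rightarrow> ('n \<Rightarrow> 'n \<Rightarrow> real) \<Rightarrow> ('n \<Rightarrow> 'n \<Rightarrow> real) \<Rightarrow>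
    'n \<Rightarrow> 'n \<Rightarrow> 'n \<Rightarrow> 'n \<Rightarrow> 'n \<Rightarrow> 'n \<Rightarrow> real" where
  "wedge3 f g h a b c d e k =
     h a b * wedge2 f g c d e k - h a c * wedge2 f g b d e k + h a d * wedge2 f g b c e k
   - h a e * wedge2 f g b c d k + h a k * wedge2 f g b c d e + h b c * wedge2 f g a d e k
   - h b d * wedge2 f g a c e k + h b e * wedge2 f g a c d k - h b k * wedge2 f g a c d e
   + h c d * wedge2 f g a b e k - h c e * wedge2 f g a b d k + h c k * wedge2 f g a b d e
   + h d e * wedge2 f g a b c k - h d k * wedge2 f g a b c e + h e k * wedge2 f g a b c d"

text \<open>Adjacent transpositions generate all permutations, so these five sign changes amount to
  full alternation.\<close>

lemma wedge3_alternating: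
  fixes f g h :: "'n \<Rightarrow> 'n \<Rightarrow> real"
  assumes f: "\<And>x y. f x y = - f y x" and g: "\<And>x y. g x y = - g y x" and h: "\<And>x y. h x y = - h y x"
  shows "wedge3 f g h b a c d e k = - wedge3 f g h a b c d e k"
    and "wedge3 f g h a c b d e k = - wedge3 f g h a b c d e k"
    and "wedge3 f g h a b d c e k = - wedge3 f g h a b c d e k"
    and "wedge3 f g h a b c e d k = - wedge3 f g h a b c d e k"
    and "wedge3 f g h a b c d k e = - wedge3 f g h a b c d e k"
  unfolding wedge3_def wedge2_def
  by (simp_all add: f[of b a] f[of c b] f[of d c] f[of e d] f[of k e]
      g[of b a] g[of c b] g[of d c] g[of e d] g[of k e]
      h[of b a] h[of c b] h[of d c] h[of e d] h[of k e] algebra_simps)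

lemma wedge3_eq_0:
  fixes f g h :: "'n::finite \<Rightarrow> 'n \<Rightarrow> real"
  assumes f: "\<And>x y. f x y = - f y x" and g: "\<And>x y. g x y = - g y x" and h: "\<And>x y. h x y = - h y x"
    and card: "CARD('n) \<le> 5"
  shows "wedge3 f g h a b c d e k = 0"
proof -
  let ?w = "wedge3 f g h"
  note alt = wedge3_alternating[of f g h, OF f g h]
  \<comment> \<open>The digits of each fact name the two slots that agree. For adjacent slots the
    value equals its own negative. For distant slots, an adjacent swap moves the second occurrence
    one step towards the first, so the facts are obtained by increasing distance.\<close>
  have z12: "?w a a c d e k = 0" for a c d e k using alt(1)[of a a] by simp
  have z23: "?w a b b d e k = 0" for a b d e k using alt(2)[of a b b] by simp
  have z34: "?w a b c c e k = 0" for a b c e k using alt(3)[of a b c c] by simp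
  have z45: "?w a b c d d k = 0" for a b c d k using alt(4)[of a b c d d] by simp
  have z56: "?w a b c d e e = 0" for a b c d e using alt(5)[of a b c d e e] by simp
  have z13: "?w a b a d e k = 0" for a b d e k using alt(2)[of a a b] z12 by simp
  have z24: "?w a b c b e k = 0" for a b c e k using alt(3)[of a b b c] z23 by simp
  have z35: "?w a b c d c k = 0" for a b c d k using alt(4)[of a b c c d] z34 by simp
  have z46: "?w a b c d e d = 0" for a b c d e using alt(5)[of a b c d d e] z45 by simp
  have z14: "?w a b c a e k = 0" for a b c e k using alt(3)[of a b a c] z13 by simp
  have z25: "?w a b c d b k = 0" for a b c d k using alt(4)[of a b c b d] z24 by simp
  have z36: "?w a b c d e c = 0" for a b c d e using alt(5)[of a b c d c e] z35 by simp
  have z15: "?w a b c d a k = 0" for a b c d k using alt(4)[of a b c a d] z14 by simp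
  have z26: "?w a b c d e b = 0" for a b c d e using alt(5)[of a b c d b e] z25 by simp
  have z16: "?w a b c d e a = 0" for a b c d e using alt(5)[of a b c d a e] z15 by simp
  \<comment> \<open>Pigeonhole: six indices in a type with at most five elements cannot be distinct,
    and each possible coincidence is covered above.\<close>
  have "card (set [a, b, c, d, e, k]) \<le> CARD('n)"
    by (intro card_mono) auto
  then have "\<not> distinct [a, b, c, d, e, k]"
    using card distinct_card[of "[a, b, c, d, e, k]"] by (simp only: list.size) linarith
  then show ?thesis
    using z12 z23 z34 z45 z56 z13 z24 z35 z46 z14 z25 z36 z15 z26 z16 by auto
qed

text \<open>The first six permutations preserve the splitting into the pairs \<open>p, q\<close> and
  \<open>r, s\<close>; they identify the terms of one kind in the final count. The other four serve
  to bring a contracted index innermost or to reach the summation order of a definition.\<close>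

lemma sum4_reorder:
  fixes F :: "'n::finite \<Rightarrow> 'n \<Rightarrow> 'n \<Rightarrow> 'n \<Rightarrow> real"
  shows
    "(\<Sum>p\<in>UNIV. \<Sum>q\<in>UNIV. \<Sum>r\<in>UNIV. \<Sum>s\<in>UNIV. F p q r s) = (\<Sum>q\<in>UNIV. \<Sum>p\<in>UNIV. \<Sum>r\<in>UNIV. \<Sum>s\<in>UNIV. F p q r s)"
    and "(\<Sum>p\<in>UNIV. \<Sum>q\<in>UNIV. \<Sum>r\<in>UNIV. \<Sum>s\<in>UNIV. F p q r s) = (\<Sum>p\<in>UNIV. \<Sum>q\<in>UNIV. \<Sum>s\<in>UNIV. \<Sum>r\<in>UNIV. F p q r s)"
    and "(\<Sum>p\<in>UNIV. \<Sum>q\<in>UNIV. \<Sum>r\<in>UNIV. \<Sum>s\<in>UNIV. F p q r s) = (\<Sum>q\<in>UNIV. \<Sum>p\<in>UNIV. \<Sum>s\<in>UNIV. \<Sum>r\<in>UNIV. F p q r s)"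
    and "(\<Sum>p\<in>UNIV. \<Sum>q\<in>UNIV. \<Sum>r\<in>UNIV. \<Sum>s\<in>UNIV. F p q r s) = (\<Sum>r\<in>UNIV. \<Sum>s\<in>UNIV. \<Sum>p\<in>UNIV. \<Sum>q\<in>UNIV. F p q r s)"
    and "(\<Sum>p\<in>UNIV. \<Sum>q\<in>UNIV. \<Sum>r\<in>UNIV. \<Sum>s\<in>UNIV. F p q r s) = (\<Sum>s\<in>UNIV. \<Sum>r\<in>UNIV. \<Sum>p\<in>UNIV. \<Sum>q\<in>UNIV. F p q r s)"
    and "(\<Sum>p\<in>UNIV. \<Sum>q\<in>UNIV. \<Sum>r\<in>UNIV. \<Sum>s\<in>UNIV. F p q r s) = (\<Sum>r\<in>UNIV. \<Sum>s\<in>UNIV. \<Sum>q\<in>UNIV. \<Sum>p\<in>UNIV. F p q r s)"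
    and "(\<Sum>p\<in>UNIV. \<Sum>q\<in>UNIV. \<Sum>r\<in>UNIV. \<Sum>s\<in>UNIV. F p q r s) = (\<Sum>p\<in>UNIV. \<Sum>r\<in>UNIV. \<Sum>s\<in>UNIV. \<Sum>q\<in>UNIV. F p q r s)"
    and "(\<Sum>p\<in>UNIV. \<Sum>q\<in>UNIV. \<Sum>r\<in>UNIV. \<Sum>s\<in>UNIV. F p q r s) = (\<Sum>r\<in>UNIV. \<Sum>p\<in>UNIV. \<Sum>q\<in>UNIV. \<Sum>s\<in>UNIV. F p q r s)"
    and "(\<Sum>p\<in>UNIV. \<Sum>q\<in>UNIV. \<Sum>r\<in>UNIV. \<Sum>s\<in>UNIV. F p q r s) = (\<Sum>p\<in>UNIV. \<Sum>r\<in>UNIV. \<Sum>q\<in>UNIV. \<Sum>s\<in>UNIV. F p q r s)"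
    and "(\<Sum>p\<in>UNIV. \<Sum>q\<in>UNIV. \<Sum>r\<in>UNIV. \<Sum>s\<in>UNIV. F p q r s) = (\<Sum>p\<in>UNIV. \<Sum>s\<in>UNIV. \<Sum>r\<in>UNIV. \<Sum>q\<in>UNIV. F p q r s)"
proof -
  show "(\<Sum>p\<in>UNIV. \<Sum>q\<in>UNIV. \<Sum>r\<in>UNIV. \<Sum>s\<in>UNIV. F p q r s) = (\<Sum>q\<in>UNIV. \<Sum>p\<in>UNIV. \<Sum>r\<in>UNIV. \<Sum>s\<in>UNIV. F p q r s)"
    by (simp add: sum.cartesian_product)
      (rule sum.reindex_bij_witness[where i = "\<lambda>(q, p, r, s). (p, q, r, s)" and j = "\<lambda>(p, q, r, s). (q, p, r, s)"], auto)
  show "(\<Sum>p\<in>UNIV. \<Sum>q\<in>UNIV. \<Sum>r\<in>UNIV. \<Sum>s\<in>UNIV. F p q r s) = (\<Sum>p\<in>UNIV. \<Sum>q\<in>UNIV. \<Sum>s\<in>UNIV. \<Sum>r\<in>UNIV. F p q r s)"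
    by (simp add: sum.cartesian_product)
      (rule sum.reindex_bij_witness[where i = "\<lambda>(p, q, s, r). (p, q, r, s)" and j = "\<lambda>(p, q, r, s). (p, q, s, r)"], auto)
  show "(\<Sum>p\<in>UNIV. \<Sum>q\<in>UNIV. \<Sum>r\<in>UNIV. \<Sum>s\<in>UNIV. F p q r s) = (\<Sum>q\<in>UNIV. \<Sum>p\<in>UNIV. \<Sum>s\<in>UNIV. \<Sum>r\<in>UNIV. F p q r s)"
    by (simp add: sum.cartesian_product)
      (rule sum.reindex_bij_witness[where i = "\<lambda>(q, p, s, r). (p, q, r, s)" and j = "\<lambda>(p, q, r, s). (q, p, s, r)"], auto)
  show "(\<Sum>p\<in>UNIV. \<Sum>q\<in>UNIV. \<Sum>r\<in>UNIV. \<Sum>s\<in>UNIV. F p q r s) = (\<Sum>r\<in>UNIV. \<Sum>s\<in>UNIV. \<Sum>p\<in>UNIV. \<Sum>q\<in>UNIV. F p q r s)"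
    by (simp add: sum.cartesian_product)
      (rule sum.reindex_bij_witness[where i = "\<lambda>(r, s, p, q). (p, q, r, s)" and j = "\<lambda>(p, q, r, s). (r, s, p, q)"], auto)
  show "(\<Sum>p\<in>UNIV. \<Sum>q\<in>UNIV. \<Sum>r\<in>UNIV. \<Sum>s\<in>UNIV. F p q r s) = (\<Sum>s\<in>UNIV. \<Sum>r\<in>UNIV. \<Sum>p\<in>UNIV. \<Sum>q\<in>UNIV. F p q r s)"
    by (simp add: sum.cartesian_product)
      (rule sum.reindex_bij_witness[where i = "\<lambda>(s, r, p, q). (p, q, r, s)" and j = "\<lambda>(p, q, r, s). (s, r, p, q)"], auto)
  show "(\<Sum>p\<in>UNIV. \<Sum>q\<in>UNIV. \<Sum>r\<in>UNIV. \<Sum>s\<in>UNIV. F p q r s) = (\<Sum>r\<in>UNIV. \<Sum>s\<in>UNIV. \<Sum>q\<in>UNIV. \<Sum>p\<in>UNIV. F p q r s)"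
    by (simp add: sum.cartesian_product)
      (rule sum.reindex_bij_witness[where i = "\<lambda>(r, s, q, p). (p, q, r, s)" and j = "\<lambda>(p, q, r, s). (r, s, q, p)"], auto)
  show "(\<Sum>p\<in>UNIV. \<Sum>q\<in>UNIV. \<Sum>r\<in>UNIV. \<Sum>s\<in>UNIV. F p q r s) = (\<Sum>p\<in>UNIV. \<Sum>r\<in>UNIV. \<Sum>s\<in>UNIV. \<Sum>q\<in>UNIV. F p q r s)"
    by (simp add: sum.cartesian_product)
      (rule sum.reindex_bij_witness[where i = "\<lambda>(p, r, s, q). (p, q, r, s)" and j = "\<lambda>(p, q, r, s). (p, r, s, q)"], auto)
  show "(\<Sum>p\<in>UNIV. \<Sum>q\<in>UNIV. \<Sum>r\<in>UNIV. \<Sum>s\<in>UNIV. F p q r s) = (\<Sum>r\<in>UNIV. \<Sum>p\<in>UNIV. \<Sum>q\<in>UNIV. \<Sum>s\<in>UNIV. F p q r s)"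
    by (simp add: sum.cartesian_product)
      (rule sum.reindex_bij_witness[where i = "\<lambda>(r, p, q, s). (p, q, r, s)" and j = "\<lambda>(p, q, r, s). (r, p, q, s)"], auto)
  show "(\<Sum>p\<in>UNIV. \<Sum>q\<in>UNIV. \<Sum>r\<in>UNIV. \<Sum>s\<in>UNIV. F p q r s) = (\<Sum>p\<in>UNIV. \<Sum>r\<in>UNIV. \<Sum>q\<in>UNIV. \<Sum>s\<in>UNIV. F p q r s)"
    by (simp add: sum.cartesian_product)
      (rule sum.reindex_bij_witness[where i = "\<lambda>(p, r, q, s). (p, q, r, s)" and j = "\<lambda>(p, q, r, s). (p, r, q, s)"], auto)
  show "(\<Sum>p\<in>UNIV. \<Sum>q\<in>UNIV. \<Sum>r\<in>UNIV. \<Sum>s\<in>UNIV. F p q r s) = (\<Sum>p\<in>UNIV. \<Sum>s\<in>UNIV. \<Sum>r\<in>UNIV. \<Sum>q\<in>UNIV. F p q r s)"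
    by (simp add: sum.cartesian_product)
      (rule sum.reindex_bij_witness[where i = "\<lambda>(p, s, r, q). (p, q, r, s)" and j = "\<lambda>(p, q, r, s). (p, s, r, q)"], auto)
qed

lemma sum3_reorder:
  fixes F :: "'n::finite \<Rightarrow> 'n \<Rightarrow> 'n \<Rightarrow> real"
  shows "(\<Sum>p\<in>UNIV. \<Sum>q\<in>UNIV. \<Sum>r\<in>UNIV. F p q r) = (\<Sum>q\<in>UNIV. \<Sum>r\<in>UNIV. \<Sum>p\<in>UNIV. F p q r)"
    and "(\<Sum>p\<in>UNIV. \<Sum>q\<in>UNIV. \<Sum>r\<in>UNIV. F p q r) = (\<Sum>p\<in>UNIV. \<Sum>r\<in>UNIV. \<Sum>q\<in>UNIV. F p q r)"
    and "(\<Sum>p\<in>UNIV. \<Sum>q\<in>UNIV. \<Sum>r\<in>UNIV. F p q r) = (\<Sum>r\<in>UNIV. \<Sum>p\<in>UNIV. \<Sum>q\<in>UNIV. F p q r)"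
    and "(\<Sum>p\<in>UNIV. \<Sum>q\<in>UNIV. \<Sum>r\<in>UNIV. F p q r) = (\<Sum>r\<in>UNIV. \<Sum>q\<in>UNIV. \<Sum>p\<in>UNIV. F p q r)"
proof -
  show "(\<Sum>p\<in>UNIV. \<Sum>q\<in>UNIV. \<Sum>r\<in>UNIV. F p q r) = (\<Sum>q\<in>UNIV. \<Sum>r\<in>UNIV. \<Sum>p\<in>UNIV. F p q r)"
    by (simp add: sum.cartesian_product)
      (rule sum.reindex_bij_witness[where i = "\<lambda>(q, r, p). (p, q, r)" and j = "\<lambda>(p, q, r). (q, r, p)"], auto)
  show "(\<Sum>p\<in>UNIV. \<Sum>q\<in>UNIV. \<Sum>r\<in>UNIV. F p q r) = (\<Sum>p\<in>UNIV. \<Sum>r\<in>UNIV. \<Sum>q\<in>UNIV. F p q r)"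
    by (simp add: sum.cartesian_product)
      (rule sum.reindex_bij_witness[where i = "\<lambda>(p, r, q). (p, q, r)" and j = "\<lambda>(p, q, r). (p, r, q)"], auto)
  show "(\<Sum>p\<in>UNIV. \<Sum>q\<in>UNIV. \<Sum>r\<in>UNIV. F p q r) = (\<Sum>r\<in>UNIV. \<Sum>p\<in>UNIV. \<Sum>q\<in>UNIV. F p q r)"
    by (simp add: sum.cartesian_product)
      (rule sum.reindex_bij_witness[where i = "\<lambda>(r, p, q). (p, q, r)" and j = "\<lambda>(p, q, r). (r, p, q)"], auto)
  show "(\<Sum>p\<in>UNIV. \<Sum>q\<in>UNIV. \<Sum>r\<in>UNIV. F p q r) = (\<Sum>r\<in>UNIV. \<Sum>q\<in>UNIV. \<Sum>p\<in>UNIV. F p q r)"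
    by (simp add: sum.cartesian_product)
      (rule sum.reindex_bij_witness[where i = "\<lambda>(r, q, p). (p, q, r)" and j = "\<lambda>(p, q, r). (r, q, p)"], auto)
qed

section \<open>Algebraic curvature tensors\<close>

locale algebraic_curvature =
  fixes K :: "'n::finite \<Rightarrow> 'n \<Rightarrow> 'n \<Rightarrow> 'n \<Rightarrow> real"
  assumes antisym12: "K b a c d = - K a b c d"
    and antisym34: "K a b d c = - K a b c d"
    and bianchi: "K a b c d + K b c a d + K c a b d = 0"
begin

text \<open>The octahedron argument: in a suitable combination of the four Bianchi identities
  obtained by cycling \<open>a, b, c, d\<close>, everything but the two wanted terms cancels by skew
  symmetry.\<close>

lemma pair_sym: "K c d a b = K a b c d"
  using antisym34[of c d b a] antisym34[of b d c a] antisym34[of b c d a] antisym34[of a d c b]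
      antisym34[of a c d b] antisym34[of a b d c] antisym12[of d b c a]
      antisym12[of d a c b] antisym12[of d a b c] antisym12[of c a b d]
      bianchi[of a b c d] bianchi[of b c d a] bianchi[of c d a b] bianchi[of d a b c]
  by linarith

text \<open>Pair symmetry carries the cyclic sum from the first three slots to the last three, where
  \<open>ring_flip_eq\<close> applies it.\<close>

lemma bianchi': "K a b c d + K a c d b + K a d b c = 0"
  using pair_sym[of b a d c] pair_sym[of c a d b] pair_sym[of c b d a] antisym34[of a d c b]
      antisym34[of a b d c] antisym12[of d c b a] antisym12[of d a c b]
      antisym12[of c b d a] antisym12[of c a d b] antisym12[of b a d c]
      bianchi[of b c d a]
  by linarith

end

lemma sum_if_const:
  "(\<Sum>a\<in>A. if P then f a else 0) = (if P then sum f A else 0)"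
  by simp

locale einstein_curvature = algebraic_curvature K
  for K :: "'n::finite \<Rightarrow> 'n \<Rightarrow> 'n \<Rightarrow> 'n \<Rightarrow> real" +
  fixes l :: real
  assumes einstein: "(\<Sum>a\<in>UNIV. K a i j a) = (if i = j then l else 0)"
begin

section \<open>Contractions of an Einstein curvature tensor\<close>

definition nsq :: real where
  "nsq = (\<Sum>a\<in>UNIV. \<Sum>b\<in>UNIV. \<Sum>c\<in>UNIV. \<Sum>d\<in>UNIV. K a b c d * K a b c d)"

definition bar :: "'n \<Rightarrow> 'n \<Rightarrow> real" where
  "bar i j = (\<Sum>a\<in>UNIV. \<Sum>b\<in>UNIV. \<Sum>c\<in>UNIV. K i a b c * K j a b c)"

definition check :: "'n \<Rightarrow> 'n \<Rightarrow> real" where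
  "check i j = (\<Sum>u\<in>UNIV. \<Sum>v\<in>UNIV. \<Sum>a\<in>UNIV. \<Sum>b\<in>UNIV. \<Sum>c\<in>UNIV.
     K i u v j * K a b c u * K a b c v)"

definition hat :: "'n \<Rightarrow> 'n \<Rightarrow> real" where
  "hat i j = (\<Sum>b\<in>UNIV. \<Sum>c\<in>UNIV. \<Sum>d\<in>UNIV. \<Sum>u\<in>UNIV. \<Sum>v\<in>UNIV.
     K i b c d * K j b u v * K c d u v)"

definition ring :: "'n \<Rightarrow> 'n \<Rightarrow> real" where
  "ring i j = (\<Sum>b\<in>UNIV. \<Sum>c\<in>UNIV. \<Sum>d\<in>UNIV. \<Sum>u\<in>UNIV. \<Sum>v\<in>UNIV.
     K i b c d * K j u c v * K b u d v)"

text \<open>The signs follow the convention \<open>R_1221 = k\<close>: tracing the outer or the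
  inner two slots gives \<open>l\<close>, tracing slots 1, 3 or 2, 4 gives
  \<open>- l\<close>.\<close>

lemma contraction:
  "(\<Sum>a\<in>UNIV. K a i j a) = (if i = j then l else 0)"
  "(\<Sum>a\<in>UNIV. K a i a j) = (if i = j then - l else 0)"
  "(\<Sum>a\<in>UNIV. K i a a j) = (if i = j then l else 0)"
  "(\<Sum>a\<in>UNIV. K i a j a) = (if i = j then - l else 0)"
proof -
  show 1: "(\<Sum>a\<in>UNIV. K a i j a) = (if i = j then l else 0)" for i j by (rule einstein)
  have "(\<Sum>a\<in>UNIV. K a i a j) = - (\<Sum>a\<in>UNIV. K a i j a)" for i j
    by (simp add: antisym34[of _ i j] sum_negf)
  then show 2: "(\<Sum>a\<in>UNIV. K a i a j) = (if i = j then - l else 0)" for i j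
    by (simp add: 1)
  have "(\<Sum>a\<in>UNIV. K i a a j) = - (\<Sum>a\<in>UNIV. K a i a j)"
    by (simp add: antisym12[of i] sum_negf)
  then show "(\<Sum>a\<in>UNIV. K i a a j) = (if i = j then l else 0)"
    by (simp add: 2)
  have "(\<Sum>a\<in>UNIV. K i a j a) = - (\<Sum>a\<in>UNIV. K a i j a)"
    by (simp add: antisym12[of i] sum_negf)
  then show "(\<Sum>a\<in>UNIV. K i a j a) = (if i = j then - l else 0)"
    by (simp add: 1)
qed

text \<open>Factors free of the innermost index are pulled out of its sum until a bare trace
  remains; the resulting Kronecker delta then collapses the next sum. This works only if the traced
  index is innermost, which explains the reorderings below.\<close>

lemmas contract = sum_distrib_left[symmetric] sum_distrib_right[symmetric] sum_negf contraction
  mult_delta_left mult_delta_right sum_if_const mult.assoc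

text \<open>The quadratic Gauss-Bonnet integrand \<tau>^2 - 4 |\<rho>|^2 + |R|^2, evaluated at
  \<rho> = l g.\<close>

lemma wedge2_total:
  defines "n \<equiv> real CARD('n)"
  shows "(\<Sum>p\<in>UNIV. \<Sum>q\<in>UNIV. \<Sum>r\<in>UNIV. \<Sum>s\<in>UNIV. wedge2 (K p q) (K r s) p q r s)
    = n\<^sup>2 * l\<^sup>2 - 4 * n * l\<^sup>2 + nsq"
proof -
  let ?S = "\<lambda>F. \<Sum>p\<in>UNIV. \<Sum>q\<in>UNIV. \<Sum>r\<in>UNIV. \<Sum>s\<in>UNIV. F p q r s :: real"
  have 1: "?S (\<lambda>p q r s. K p q p q * K r s r s) = n\<^sup>2 * l\<^sup>2"
    by (simp add: contract n_def power2_eq_square)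
  have 2: "?S (\<lambda>p q r s. K p q p r * K r s q s) = n * l\<^sup>2"
    by (simp add: contract n_def power2_eq_square)
  have 3: "?S (\<lambda>p q r s. K p q p s * K r s q r) = - n * l\<^sup>2"
    by (subst sum4_reorder(2)) (simp add: contract n_def power2_eq_square)
  have 4: "?S (\<lambda>p q r s. K p q q r * K r s p s) = - n * l\<^sup>2"
    by (simp add: contract n_def power2_eq_square)
  have 5: "?S (\<lambda>p q r s. K p q q s * K r s p r) = n * l\<^sup>2"
    by (subst sum4_reorder(2)) (simp add: contract n_def power2_eq_square)
  have 6: "?S (\<lambda>p q r s. K p q r s * K r s p q) = nsq"
    by (simp add: nsq_def pair_sym)
  show ?thesis
    using 1 2 3 4 5 6 by (simp add: wedge2_def sum.distrib sum_subtractf)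
qed

text \<open>These are the shapes in which \<open>bar\<close> appears once the Ricci traces are
  removed from the cubic terms; \<open>i\<close> is in the second slot because the third factor of
  the 6-form is \<open>K t i\<close>.\<close>

lemma bar_variants:
  shows "(\<Sum>t\<in>UNIV. \<Sum>p\<in>UNIV. \<Sum>q\<in>UNIV. K t i p q * K t j p q) = bar i j"
    and "(\<Sum>t\<in>UNIV. \<Sum>p\<in>UNIV. \<Sum>q\<in>UNIV. K t i p q * K p q t j) = bar i j"
    and "(\<Sum>t\<in>UNIV. \<Sum>p\<in>UNIV. \<Sum>q\<in>UNIV. K t i p q * K p q j t) = - bar i j"
    and "(\<Sum>t\<in>UNIV. \<Sum>p\<in>UNIV. \<Sum>q\<in>UNIV. K t i p q * K q p t j) = - bar i j"
proof -
  show 1: "(\<Sum>t\<in>UNIV. \<Sum>p\<in>UNIV. \<Sum>q\<in>UNIV. K t i p q * K t j p q) = bar i j"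
    unfolding bar_def by (simp add: antisym12[of _ i] antisym12[of _ j])
  have h: "K p q t j = K t j p q" "K p q j t = - K t j p q" "K q p t j = - K t j p q" for p q t
    using pair_sym[of p q t j] pair_sym[of p q j t] antisym12[of t j p q] antisym12[of p q t j] by simp_all
  show "(\<Sum>t\<in>UNIV. \<Sum>p\<in>UNIV. \<Sum>q\<in>UNIV. K t i p q * K p q t j) = bar i j"
    unfolding 1[symmetric] h(1) ..
  show "(\<Sum>t\<in>UNIV. \<Sum>p\<in>UNIV. \<Sum>q\<in>UNIV. K t i p q * K p q j t) = - bar i j"
    unfolding 1[symmetric] h(2) sum_negf[symmetric] by simp
  have "K t i p q * K q p t j = - (K t i p q * K t j p q)" for t p q
    using h(3)[of q p t] by simp
  then show "(\<Sum>t\<in>UNIV. \<Sum>p\<in>UNIV. \<Sum>q\<in>UNIV. K t i p q * K q p t j) = - bar i j"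
    unfolding 1[symmetric] sum_negf[symmetric] by (intro sum.cong refl)
qed

text \<open>The Ricci-type analogue of \<open>wedge2_total\<close>: \<tau> \<rho> minus twice the
  square of \<rho>, minus twice the contraction of the curvature with \<rho>, plus
  \<open>bar\<close>, evaluated at \<rho> = l g.\<close>

lemma bar_total:
  defines "n \<equiv> real CARD('n)"
  shows "(\<Sum>p\<in>UNIV. \<Sum>q\<in>UNIV. \<Sum>r\<in>UNIV. wedge2 (K p q) (K r i) p q r j)
    = (n - 4) * (if i = j then l\<^sup>2 else 0) + bar i j"
proof -
  let ?S = "\<lambda>F. \<Sum>p\<in>UNIV. \<Sum>q\<in>UNIV. \<Sum>r\<in>UNIV. F p q r :: real"
  have 1: "?S (\<lambda>p q r. K p q p q * K r i r j) = n * (if i = j then l\<^sup>2 else 0)"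
    by (simp add: contract power2_eq_square power3_eq_cube n_def)
  have 2: "?S (\<lambda>p q r. K p q p r * K r i q j) = (if i = j then l\<^sup>2 else 0)"
    by (subst sum3_reorder(1)) (simp add: contract power2_eq_square power3_eq_cube n_def)
  have 3: "?S (\<lambda>p q r. K p q p j * K r i q r) = (if i = j then - l\<^sup>2 else 0)"
    by (simp add: contract power2_eq_square power3_eq_cube n_def)
  have 4: "?S (\<lambda>p q r. K p q q r * K r i p j) = (if i = j then - l\<^sup>2 else 0)"
    by (subst sum3_reorder(2)) (simp add: contract power2_eq_square power3_eq_cube n_def)
  have 5: "?S (\<lambda>p q r. K p q q j * K r i p r) = (if i = j then l\<^sup>2 else 0)"
    by (simp add: contract power2_eq_square power3_eq_cube n_def)
  have 6: "?S (\<lambda>p q r. K p q r j * K r i p q) = bar i j"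
    by (subst sum3_reorder(3)) (simp add: bar_variants(2)[symmetric] mult.commute)
  show ?thesis
    using 1 2 3 4 5 6
    by (simp add: wedge2_def sum.distrib sum_subtractf distrib_left right_diff_distrib left_diff_distrib)
qed

text \<open>\<open>K t i\<close> receives both indices of one factor. Only the chain
  \<open>K t i p q\<close>, \<open>K p q r s\<close>, \<open>K r s t j\<close> is free of Ricci
  traces; in the other five terms \<open>K r s\<close> is traced, which leaves multiples of
  \<open>bar\<close>.\<close>

lemma hat_total:
  defines "n \<equiv> real CARD('n)"
  shows "(\<Sum>t\<in>UNIV. \<Sum>p\<in>UNIV. \<Sum>q\<in>UNIV. \<Sum>r\<in>UNIV. \<Sum>s\<in>UNIV. K t i p q * wedge2 (K p q) (K r s) r s t j)
    = hat i j + (4 - n) * l * bar i j"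
proof -
  let ?S = "\<lambda>F. \<Sum>t\<in>UNIV. \<Sum>p\<in>UNIV. \<Sum>q\<in>UNIV. \<Sum>r\<in>UNIV. \<Sum>s\<in>UNIV. F t p q r s :: real"
  have *: "K t i p q * (K p q r s * K r s t j) = K i t p q * K j t r s * K p q r s" for t p q r s
    using antisym12[of t i p q] pair_sym[of r s t j] antisym12[of t j r s]
    by simp
  have 1: "?S (\<lambda>t p q r s. K t i p q * (K p q r s * K r s t j)) = hat i j"
    by (simp only: hat_def *)
  have 2: "?S (\<lambda>t p q r s. K t i p q * (K p q r t * K r s s j)) = - l * bar i j"
    by (simp add: contract bar_variants n_def mult.left_commute[of _ l] mult.commute[of _ l])
  have 3: "?S (\<lambda>t p q r s. K t i p q * (K p q r j * K r s s t)) = l * bar i j"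
    by (simp add: contract bar_variants n_def mult.left_commute[of _ l] mult.commute[of _ l])
  have 4: "?S (\<lambda>t p q r s. K t i p q * (K p q s t * K r s r j)) = l * bar i j"
    by (subst sum4_reorder(2)) (simp add: contract bar_variants n_def mult.left_commute[of _ l] mult.commute[of _ l])
  have 5: "?S (\<lambda>t p q r s. K t i p q * (K p q s j * K r s r t)) = - l * bar i j"
    by (subst sum4_reorder(2)) (simp add: contract bar_variants n_def mult.left_commute[of _ l] mult.commute[of _ l])
  have 6: "?S (\<lambda>t p q r s. K t i p q * (K p q t j * K r s r s)) = - n * l * bar i j"
    by (simp add: contract bar_variants n_def mult.left_commute[of _ l] mult.commute[of _ l])
  show ?thesis
    using 1 2 3 4 5 6
    by (simp add: wedge2_def sum.distrib sum_subtractf distrib_left right_diff_distrib left_diff_distrib)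
qed

text \<open>\<open>ring\<close> with other slots in the last factor: the contraction that arises
  when \<open>K t i\<close> receives one index from each of the other factors.\<close>

definition ring_flip :: "'n \<Rightarrow> 'n \<Rightarrow> real" where
  "ring_flip i j = (\<Sum>b\<in>UNIV. \<Sum>c\<in>UNIV. \<Sum>d\<in>UNIV. \<Sum>u\<in>UNIV. \<Sum>v\<in>UNIV.
     K i b c d * K j u c v * K d u v b)"

text \<open>Here \<open>K t i\<close> receives one index of each pair, so the remaining pairs
  interlock. The fourth and fifth terms contain no Ricci trace; with the signs of
  \<open>wedge2\<close> each of them contributes \<open>- ring_flip i j\<close>.\<close>

lemma cubic_total:
  defines "n \<equiv> real CARD('n)"
  shows "(\<Sum>t\<in>UNIV. \<Sum>p\<in>UNIV. \<Sum>q\<in>UNIV. \<Sum>r\<in>UNIV. \<Sum>s\<in>UNIV. K t i p r * wedge2 (K p q) (K r s) q s t j)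
    = - 2 * l * bar i j + 2 * (if i = j then l ^ 3 else 0) - 2 * ring_flip i j"
proof -
  let ?S = "\<lambda>F. \<Sum>t\<in>UNIV. \<Sum>p\<in>UNIV. \<Sum>q\<in>UNIV. \<Sum>r\<in>UNIV. \<Sum>s\<in>UNIV. F t p q r s :: real"
  have 1: "?S (\<lambda>t p q r s. K t i p r * (K p q q s * K r s t j)) = - l * bar i j"
    by (subst sum4_reorder(7)) (simp add: contract bar_variants n_def mult.left_commute[of _ l] mult.commute[of _ l])
  have 2: "?S (\<lambda>t p q r s. K t i p r * (K p q q t * K r s s j)) = (if i = j then - (l ^ 3) else 0)"
    by (subst sum4_reorder(7)) (simp add: contract power2_eq_square power3_eq_cube n_def)
  have 3: "?S (\<lambda>t p q r s. K t i p r * (K p q q j * K r s s t)) = (if i = j then l ^ 3 else 0)"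
    by (subst sum4_reorder(7)) (simp add: contract power2_eq_square power3_eq_cube n_def)
  have *: "K t i p r * (K p q s t * K r s q j) = - (K i t r p * K j q r s * K p q s t)" for t p q r s
    using antisym12[of t i p r] antisym34[of i t p r] pair_sym[of r s q j] antisym12[of q j r s]
    by simp
  have 4: "?S (\<lambda>t p q r s. K t i p r * (K p q s t * K r s q j)) = - ring_flip i j"
    by (subst sum4_reorder(8)) (simp only: ring_flip_def sum_negf[symmetric] *)
  have *: "K t i p r * (K p q s j * K r s q t) = K i t p r * K j s p q * K r s q t" for t p q r s
    using antisym12[of t i p r] pair_sym[of p q s j] antisym12[of s j p q]
    by simp
  have 5: "?S (\<lambda>t p q r s. K t i p r * (K p q s j * K r s q t)) = ring_flip i j"
    by (subst sum4_reorder(7)) (simp only: ring_flip_def *)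
  have 6: "?S (\<lambda>t p q r s. K t i p r * (K p q t j * K r s q s)) = - l * bar i j"
    by (subst sum4_reorder(9)) (simp add: contract bar_variants n_def mult.left_commute[of _ l] mult.commute[of _ l])
  show ?thesis
    using 1 2 3 4 5 6
    by (simp add: wedge2_def sum.distrib sum_subtractf distrib_left right_diff_distrib left_diff_distrib)
qed

text \<open>\<open>K t i\<close> receives one summed index and \<open>j\<close>. Every term but the
  fourth has a Ricci trace and reduces to a multiple of the third power of \<open>l\<close>.\<close>

lemma check_total:
  defines "n \<equiv> real CARD('n)"
  shows "(\<Sum>t\<in>UNIV. \<Sum>p\<in>UNIV. \<Sum>q\<in>UNIV. \<Sum>r\<in>UNIV. \<Sum>s\<in>UNIV. K t i p j * wedge2 (K p q) (K r s) q r s t)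
    = (n - 4) * (if i = j then l ^ 3 else 0) + check i j"
proof -
  let ?S = "\<lambda>F. \<Sum>t\<in>UNIV. \<Sum>p\<in>UNIV. \<Sum>q\<in>UNIV. \<Sum>r\<in>UNIV. \<Sum>s\<in>UNIV. F t p q r s :: real"
  have 1: "?S (\<lambda>t p q r s. K t i p j * (K p q q r * K r s s t)) = (if i = j then - (l ^ 3) else 0)"
    by (subst sum4_reorder(7)) (simp add: contract power2_eq_square power3_eq_cube n_def)
  have 2: "?S (\<lambda>t p q r s. K t i p j * (K p q q s * K r s r t)) = (if i = j then l ^ 3 else 0)"
    by (subst sum4_reorder(10)) (simp add: contract power2_eq_square power3_eq_cube n_def)
  have 3: "?S (\<lambda>t p q r s. K t i p j * (K p q q t * K r s r s)) = n * (if i = j then l ^ 3 else 0)"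
    by (subst sum4_reorder(7)) (simp add: contract power2_eq_square power3_eq_cube n_def)
  have *: "K t i p j * (K p q r s * K r s q t) = K i t p j * K s r q t * K s r q p" for t p q r s
    using antisym12[of t i p j] pair_sym[of p q r s] antisym12[of r s p q] antisym34[of s r p q] antisym12[of r s q t]
    by simp
  have 4: "?S (\<lambda>t p q r s. K t i p j * (K p q r s * K r s q t)) = check i j"
    by (subst sum4_reorder(10)) (simp only: check_def *)
  have 5: "?S (\<lambda>t p q r s. K t i p j * (K p q r t * K r s q s)) = (if i = j then l ^ 3 else 0)"
    by (simp add: contract power2_eq_square power3_eq_cube n_def)
  have 6: "?S (\<lambda>t p q r s. K t i p j * (K p q s t * K r s q r)) = (if i = j then - (l ^ 3) else 0)"
    by (subst sum4_reorder(2)) (simp add: contract power2_eq_square power3_eq_cube n_def)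
  show ?thesis
    using 1 2 3 4 5 6
    by (simp add: wedge2_def sum.distrib sum_subtractf distrib_left right_diff_distrib left_diff_distrib)
qed

text \<open>Bianchi in the last factor replaces \<open>ring_flip\<close> by \<open>ring\<close> and
  a remainder whose last factor is \<open>K b d v u\<close>. As this factor is skew in
  \<open>b, d\<close> and in \<open>u, v\<close>, the first two factors may be antisymmetrised;
  Bianchi turns each antisymmetrisation into a single component, at the cost of a factor 1/2 each
  time. The outcome is \<open>hat\<close> with coefficient 1/4.\<close>

lemma ring_flip_eq: "ring_flip i j = hat i j / 4 - ring i j"
proof -
  let ?S = "\<lambda>F. \<Sum>b\<in>UNIV. \<Sum>c\<in>UNIV. \<Sum>d\<in>UNIV. \<Sum>u\<in>UNIV. \<Sum>v\<in>UNIV. F b c d u v :: real"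
  let ?Y = "\<lambda>b c d u v. K i b c d * K j u c v * K b d v u"
  let ?Z = "\<lambda>b c d u v. K i c b d * K j u c v * K b d v u"
  have 1: "ring_flip i j = - ring i j - ?S ?Y"
  proof -
    have "K i b c d * K j u c v * K d u v b = - (K i b c d * K j u c v * K b u d v) - ?Y b c d u v" for b c d u v
    proof -
      have e: "K d u v b = - K b u d v - K b d v u"
        using bianchi'[of b v u d] pair_sym[of d u v b] antisym12[of v b d u] antisym34[of b v u d]
        by linarith
      show ?thesis unfolding e by (simp add: algebra_simps)
    qed
    then show ?thesis
      by (simp add: ring_flip_def ring_def sum_subtractf sum_negf)
  qed
  \<comment> \<open>Average over the exchange of \<open>b\<close> and \<open>d\<close>, then apply
    Bianchi to the factor with \<open>i\<close>.\<close>
  have 2: "2 * ?S ?Y = ?S ?Z"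
  proof -
    have "?S ?Y = ?S (\<lambda>b c d u v. ?Y d c b u v)"
      by (rule sum3_reorder(4))
    then have "2 * ?S ?Y = ?S (\<lambda>b c d u v. ?Y b c d u v + ?Y d c b u v)"
      by (simp add: sum.distrib)
    moreover have "?Y b c d u v + ?Y d c b u v = ?Z b c d u v" for b c d u v
    proof -
      have e: "K i c b d = K i b c d - K i d c b"
        using bianchi'[of i b c d] antisym34[of i c b d] antisym34[of i d b c] by linarith
      show ?thesis
        unfolding e using antisym12[of d b v u] by (simp add: algebra_simps)
    qed
    ultimately show ?thesis by simp
  qed
  \<comment> \<open>The same with the exchange of \<open>u\<close> and \<open>v\<close> and the
    factor with \<open>j\<close>; swapping the names \<open>b\<close> and \<open>c\<close> then
    gives \<open>hat\<close>.\<close>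
  have 3: "2 * ?S ?Z = - hat i j"
  proof -
    have "?S ?Z = ?S (\<lambda>b c d u v. ?Z b c d v u)"
      by (rule sum.cong[OF refl], rule sum.cong[OF refl], rule sum.cong[OF refl], rule sum.swap)
    then have "2 * ?S ?Z = ?S (\<lambda>b c d u v. ?Z b c d u v + ?Z b c d v u)"
      by (simp add: sum.distrib)
    moreover have "?Z b c d u v + ?Z b c d v u = - (K i c b d * K j c u v * K b d u v)" for b c d u v
    proof -
      have e: "K j c u v = K j u c v - K j v c u"
        using bianchi'[of j u c v] antisym34[of j c u v] antisym34[of j v u c] by linarith
      show ?thesis
        unfolding e using antisym34[of b d u v] by (simp add: algebra_simps)
    qed
    moreover have "?S (\<lambda>b c d u v. - (K i c b d * K j c u v * K b d u v)) = - hat i j"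
      by (subst sum.swap) (simp add: hat_def sum_negf)
    ultimately show ?thesis by simp
  qed
  from 1 2 3 show ?thesis by simp
qed

text \<open>The groups collect the pair received by \<open>K t i\<close>: \<open>t, j\<close>;
  \<open>t\<close> and a summed index; a whole pair \<open>p, q\<close> or \<open>r, s\<close>; one
  index of each; \<open>j\<close> and a summed index. Within a group the factors and arguments are
  arranged so that every term is the first one with \<open>p, q, r, s\<close> renamed, which makes
  the sums over a group equal.\<close>

lemma wedge3_expand:
  "wedge3 (K p q) (K r s) (K t i) p q r s t j
   = K t i t j * wedge2 (K p q) (K r s) p q r s
   + (K t i s t * wedge2 (K p q) (K r s) p q r j + K t i r t * wedge2 (K p q) (K s r) p q s j
      + K t i q t * wedge2 (K r s) (K p q) r s p j + K t i p t * wedge2 (K r s) (K q p) r s q j)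
   + (K t i p q * wedge2 (K p q) (K r s) r s t j + K t i r s * wedge2 (K r s) (K p q) p q t j)
   - (K t i p r * wedge2 (K p q) (K r s) q s t j + K t i q r * wedge2 (K q p) (K r s) p s t j
      + K t i p s * wedge2 (K p q) (K s r) q r t j + K t i q s * wedge2 (K q p) (K s r) p r t j)
   + (K t i p j * wedge2 (K p q) (K r s) q r s t + K t i q j * wedge2 (K q p) (K r s) p r s t
      + K t i r j * wedge2 (K r s) (K p q) s p q t + K t i s j * wedge2 (K s r) (K p q) r p q t)"
proof -
  have flip: "K q p = (\<lambda>x y. - K p q x y)" for p q
    by (intro ext antisym12)
  have neg: "wedge2 (\<lambda>x y. - f x y) g w x y z = - wedge2 f g w x y z"
    "wedge2 f (\<lambda>x y. - g x y) w x y z = - wedge2 f g w x y z" for f g :: "'n \<Rightarrow> 'n \<Rightarrow> real" and w x y z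
    by (simp_all add: wedge2_def)
  have comm: "wedge2 (K r s) (K p q) w x y z = wedge2 (K p q) (K r s) w x y z" for w x y z
    by (simp add: wedge2_def)
  \<comment> \<open>A 4-form is unchanged by a cyclic permutation of three arguments, since this is
    even.\<close>
  have cyc: "wedge2 (K p q) (K r s) x y w z = wedge2 (K p q) (K r s) w x y z" for w x y z
    by (simp add: wedge2_def antisym34[of _ _ x w] antisym34[of _ _ y w])
  show ?thesis
    unfolding wedge3_def flip[of q p] flip[of s r] neg comm
    using cyc[of r s p j] cyc[of r s q j] cyc[of s p q t] cyc[of r p q t]
      cyc[of q s p t] cyc[of q r p t]
    by simp
qed

text \<open>The trace over \<open>t\<close> is \<open>l\<close> times a Kronecker delta that sets
  \<open>s = i\<close>; thus \<open>K r s\<close> becomes the \<open>K r i\<close> of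
  \<open>bar_total\<close>.\<close>

lemma sum_K_trace: "(\<Sum>t\<in>UNIV. \<Sum>p\<in>UNIV. \<Sum>q\<in>UNIV. \<Sum>r\<in>UNIV. \<Sum>s\<in>UNIV. K t i s t * F p q r s)
   = l * (\<Sum>p\<in>UNIV. \<Sum>q\<in>UNIV. \<Sum>r\<in>UNIV. F p q r i)"
proof -
  have "(\<Sum>t\<in>UNIV. \<Sum>p\<in>UNIV. \<Sum>q\<in>UNIV. \<Sum>r\<in>UNIV. \<Sum>s\<in>UNIV. K t i s t * F p q r s)
      = (\<Sum>p\<in>UNIV. \<Sum>q\<in>UNIV. \<Sum>r\<in>UNIV. \<Sum>s\<in>UNIV. \<Sum>t\<in>UNIV. K t i s t * F p q r s)"
    by ((subst sum.swap, rule sum.cong[OF refl])+, rule refl)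
  then show ?thesis by (simp add: contract)
qed

lemma curvature_identity:
  assumes "CARD('n) = 5"
  shows "10 * l * bar i j + 4 * check i j + 4 * hat i j - 8 * ring i j
    = (5 * l ^ 3 + l * nsq) * (if i = j then 1 else 0)"
proof -
  let ?S = "\<lambda>F. \<Sum>t\<in>UNIV. \<Sum>p\<in>UNIV. \<Sum>q\<in>UNIV. \<Sum>r\<in>UNIV. \<Sum>s\<in>UNIV. F t p q r s :: real"
  let ?A = "\<lambda>t p q r s. K t i t j * wedge2 (K p q) (K r s) p q r s"
  let ?B = "\<lambda>t p q r s. K t i s t * wedge2 (K p q) (K r s) p q r j"
  let ?C = "\<lambda>t p q r s. K t i p q * wedge2 (K p q) (K r s) r s t j"
  let ?D = "\<lambda>t p q r s. K t i p r * wedge2 (K p q) (K r s) q s t j"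
  let ?E = "\<lambda>t p q r s. K t i p j * wedge2 (K p q) (K r s) q r s t"
  have perm:
    "?S (\<lambda>t p q r s. F t q p r s) = ?S F" "?S (\<lambda>t p q r s. F t p q s r) = ?S F"
    "?S (\<lambda>t p q r s. F t q p s r) = ?S F" "?S (\<lambda>t p q r s. F t r s p q) = ?S F"
    "?S (\<lambda>t p q r s. F t r s q p) = ?S F" "?S (\<lambda>t p q r s. F t s r p q) = ?S F" for F :: "'n \<Rightarrow> 'n \<Rightarrow> 'n \<Rightarrow> 'n \<Rightarrow> 'n \<Rightarrow> real"
    by (rule sum.cong[OF refl], rule sum4_reorder[symmetric])+
  have "0 = ?S (\<lambda>t p q r s. wedge3 (K p q) (K r s) (K t i) p q r s t j)"
  proof -
    have "wedge3 (K p q) (K r s) (K t i) p q r s t j = 0" for p q r s t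
      by (rule wedge3_eq_0[OF antisym34 antisym34 antisym34]) (simp add: assms)
    then show ?thesis by simp
  qed
  also have "\<dots> = ?S ?A + 4 * ?S ?B + 2 * ?S ?C - 4 * ?S ?D + 4 * ?S ?E"
    using perm[of ?B] perm[of ?C] perm[of ?D] perm[of ?E]
    unfolding wedge3_expand sum.distrib sum_subtractf by linarith
  also have "?S ?A = (if i = j then - l else 0) * (5 * l\<^sup>2 + nsq)"
    using wedge2_total assms by (simp add: contract)
  also have "?S ?B = l * ((if i = j then l\<^sup>2 else 0) + bar i j)"
    using bar_total[of i j] assms by (simp add: sum_K_trace)
  also have "?S ?C = hat i j - l * bar i j"
    using hat_total[of i j] assms by simp
  also note cubic_total[of i j]
  also have "?S ?E = (if i = j then l ^ 3 else 0) + check i j"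
    using check_total[of i j] assms by simp
  \<comment> \<open>With multiplicities 1, 4, 2, -4, 4 the product of \<open>l\<close> and
    \<open>bar\<close> gets 4 - 2 + 8 = 10, and the third power of \<open>l\<close> gets -5 + 4 - 8
    + 4 = -5.\<close>
  finally show ?thesis
    by (simp add: ring_flip_eq algebra_simps power2_eq_square power3_eq_cube split: if_splits)
qed

text \<open>\<open>check\<close> is the contraction of \<open>bar\<close> with the two inner slots
  of the curvature. For \<open>bar\<close> equal to \<open>c\<close> times the metric this
  contraction is \<open>c\<close> times the Ricci tensor.\<close>

lemma check_of_scalar_bar:
  assumes bar: "\<And>u v. bar u v = (if u = v then c else 0)"
  shows "check i j = (if i = j then c * l else 0)"
proof -
  have "(\<Sum>a\<in>UNIV. \<Sum>b\<in>UNIV. \<Sum>c\<in>UNIV. K a b c u * K a b c v) = bar u v" for u v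
  proof -
    \<comment> \<open>Reversing all four slots moves the free index to the front, as in the
      definition of \<open>bar\<close>.\<close>
    have "K a b c w = K w c b a" for a b c w
      using pair_sym[of a b c w] antisym12[of c w a b] antisym34[of w c a b] by simp
    then have "K a b c u * K a b c v = K u c b a * K v c b a" for a b c
      by metis
    then show ?thesis
      unfolding bar_def by (simp only:) (rule sum3_reorder(4))
  qed
  then have "check i j = (\<Sum>u\<in>UNIV. \<Sum>v\<in>UNIV. K i u v j * bar u v)"
    by (simp only: check_def mult.assoc sum_distrib_left[symmetric])
  then show ?thesis
    by (simp add: bar mult_delta_right sum_distrib_right[symmetric] contraction mult_delta_left)
qed

end

section \<open>Smooth functions and vector fields\<close>

lemma Ck_on_subset: "Ck_on k S f \<Longrightarrow> T \<subseteq> S \<Longrightarrow> Ck_on k T f"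
  by (induction k arbitrary: f) (auto intro: continuous_on_subset)

lemma smooth_on_subset: "smooth_on S f \<Longrightarrow> T \<subseteq> S \<Longrightarrow> smooth_on T f"
  by (auto simp: smooth_on_def intro: Ck_on_subset)

text \<open>A derivative at a point depends only on values nearby, so agreement on the open set
  \<open>S\<close> passes to all iterated derivatives.\<close>

lemma Ck_on_cong:
  assumes "open S" "\<And>x. x \<in> S \<Longrightarrow> f x = h x" "Ck_on k S f"
  shows "Ck_on k S h"
  using assms(2,3)
proof (induction k arbitrary: f h)
  case 0
  then show ?case by (simp cong: continuous_on_cong)
next
  case (Suc k)
  have d: "(h has_derivative frechet_derivative f (at x)) (at x)" if "x \<in> S" for x
    by (rule has_derivative_transform_within_open[where f = f, OF _ assms(1) that])
      (use Suc.prems that in \<open>auto simp: frechet_derivative_works[symmetric]\<close>)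
  have eq: "frechet_derivative f (at x) v = frechet_derivative h (at x) v" if "x \<in> S" for x v
    using frechet_derivative_at[OF d[OF that]] by simp
  have "Ck_on k S (\<lambda>x. frechet_derivative h (at x) v)" for v
    by (rule Suc.IH[of "\<lambda>x. frechet_derivative f (at x) v"]) (use eq Suc.prems in auto)
  then show ?case
    using d by (auto simp: differentiable_def)
qed

lemma smooth_on_differentiable: "smooth_on S f \<Longrightarrow> x \<in> S \<Longrightarrow> f differentiable (at x)"
  unfolding smooth_on_def by (metis Ck_on.simps(2))

lemma smooth_on_derivative: "smooth_on S f \<Longrightarrow> smooth_on S (\<lambda>x. frechet_derivative f (at x) v)"
  unfolding smooth_on_def by (metis Ck_on.simps(2))

lemma smooth_on_continuous: "smooth_on S f \<Longrightarrow> continuous_on S f"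
  unfolding smooth_on_def by (metis Ck_on.simps(1))

lemma smooth_on_const: "smooth_on S (\<lambda>x. c)"
proof -
  have "Ck_on k S (\<lambda>x. c)" for k
    by (induction k arbitrary: c) simp_all
  then show ?thesis by (simp add: smooth_on_def)
qed

lemma Ck_on_add:
  assumes "open S" "Ck_on k S f" "Ck_on k S h"
  shows "Ck_on k S (\<lambda>x. f x + h x)"
  using assms(2,3)
proof (induction k arbitrary: f h)
  case 0
  then show ?case by (simp add: continuous_on_add)
next
  case (Suc k)
  have "Ck_on k S (\<lambda>x. frechet_derivative (\<lambda>x. f x + h x) (at x) v)" for v
  proof (rule Ck_on_cong[OF assms(1)])
    show "Ck_on k S (\<lambda>x. frechet_derivative f (at x) v + frechet_derivative h (at x) v)"
      using Suc by simp
    fix x assume "x \<in> S"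
    then have "((\<lambda>x. f x + h x) has_derivative
        (\<lambda>v. frechet_derivative f (at x) v + frechet_derivative h (at x) v)) (at x)"
      using Suc.prems by (intro has_derivative_add) (auto simp: frechet_derivative_works[symmetric])
    from frechet_derivative_at[OF this]
    show "frechet_derivative f (at x) v + frechet_derivative h (at x) v
        = frechet_derivative (\<lambda>x. f x + h x) (at x) v"
      by metis
  qed
  then show ?case
    using Suc.prems by (auto intro: differentiable_add)
qed

lemma smooth_on_add:
  "open S \<Longrightarrow> smooth_on S f \<Longrightarrow> smooth_on S h \<Longrightarrow> smooth_on S (\<lambda>x. f x + h x)"
  by (simp add: smooth_on_def Ck_on_add)

lemma smooth_on_mult:
  fixes f h :: "'a::euclidean_space \<Rightarrow> real"
  assumes "open S" "smooth_on S f" "smooth_on S h"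
  shows "smooth_on S (\<lambda>x. f x * h x)"
proof -
  \<comment> \<open>The factors are taken smooth of all orders: the product rule pairs a derivative
    of one factor with the other factor itself, and smoothness supplies both at order
    \<open>k\<close> without a descent from \<open>Suc k\<close>.\<close>
  have "Ck_on k S (\<lambda>x. f x * h x)" if "smooth_on S f" "smooth_on S h" for k
    using that
  proof (induction k arbitrary: f h)
    case 0
    then show ?case by (auto intro: continuous_on_mult smooth_on_continuous)
  next
    case (Suc k)
    have "Ck_on k S (\<lambda>x. frechet_derivative (\<lambda>x. f x * h x) (at x) v)" for v
    proof (rule Ck_on_cong[OF assms(1)])
      show "Ck_on k S (\<lambda>x. f x * frechet_derivative h (at x) v + frechet_derivative f (at x) v * h x)"
        using Suc by (intro Ck_on_add assms(1) Suc.IH smooth_on_derivative)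
      fix x assume "x \<in> S"
      then have "((\<lambda>x. f x * h x) has_derivative
          (\<lambda>v. f x * frechet_derivative h (at x) v + frechet_derivative f (at x) v * h x)) (at x)"
        using Suc.prems by (intro has_derivative_mult)
          (auto simp: frechet_derivative_works[symmetric] smooth_on_differentiable)
      from frechet_derivative_at[OF this]
      show "f x * frechet_derivative h (at x) v + frechet_derivative f (at x) v * h x
          = frechet_derivative (\<lambda>x. f x * h x) (at x) v"
        by metis
    qed
    then show ?case
      using Suc.prems by (auto intro: differentiable_mult smooth_on_differentiable)
  qed
  then show ?thesis
    using assms by (simp add: smooth_on_def)
qed

context smooth_manifold
begin

lemma open_chart_image:
  assumes "(U, \<phi>) \<in> A" "openin M W"
  shows "open (\<phi> ` (W \<inter> U))"
proof -
  note c = charts[OF assms(1)]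
  have "openin (subtopology M U) (W \<inter> U)"
    using assms(2) by (rule openin_subtopology_Int)
  then have "openin (top_of_set (\<phi> ` U)) (\<phi> ` (W \<inter> U))"
    using homeomorphic_imp_open_map c unfolding open_map_def by blast
  then show ?thesis
    using c openin_open_trans by blast
qed

lemma smooth_funI:
  assumes "openin M W" "\<And>U \<phi>. (U, \<phi>) \<in> A \<Longrightarrow> smooth_on (\<phi> ` (W \<inter> U)) (\<lambda>x. f (inv_into U \<phi> x))"
  shows "smooth_fun W f"
  using assms unfolding smooth_fun_def comp_def by auto

lemma smooth_funD:
  assumes "smooth_fun W f"
  shows "openin M W" "(U, \<phi>) \<in> A \<Longrightarrow> smooth_on (\<phi> ` (W \<inter> U)) (\<lambda>x. f (inv_into U \<phi> x))"
  using assms unfolding smooth_fun_def comp_def by auto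

lemma smooth_fun_subset:
  assumes "smooth_fun W f" "V \<subseteq> W" "openin M V"
  shows "smooth_fun V f"
  using assms by (intro smooth_funI) (auto intro: smooth_on_subset[OF smooth_funD(2)[OF assms(1)]])

lemma smooth_fun_const: "openin M W \<Longrightarrow> smooth_fun W (\<lambda>q. c)"
  by (simp add: smooth_funI smooth_on_const)

lemma smooth_fun_add: "smooth_fun W f \<Longrightarrow> smooth_fun W h \<Longrightarrow> smooth_fun W (\<lambda>q. f q + h q)"
  by (rule smooth_funI, erule smooth_funD(1))
    (intro smooth_on_add open_chart_image smooth_funD(2); simp add: smooth_funD(1))

lemma smooth_fun_mult: "smooth_fun W f \<Longrightarrow> smooth_fun W h \<Longrightarrow> smooth_fun W (\<lambda>q. f q * h q)"
  by (rule smooth_funI, erule smooth_funD(1))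
    (intro smooth_on_mult open_chart_image smooth_funD(2); simp add: smooth_funD(1))

lemma smooth_nearI: "smooth_fun W f \<Longrightarrow> p \<in> W \<Longrightarrow> smooth_near p f"
  by (auto simp: smooth_near_def)

lemma smooth_nearE:
  assumes "smooth_near p f" "openin M U" "p \<in> U"
  obtains W where "smooth_fun W f" "p \<in> W" "W \<subseteq> U"
proof -
  obtain W where W: "p \<in> W" "smooth_fun W f"
    using assms(1) by (auto simp: smooth_near_def)
  then have "smooth_fun (W \<inter> U) f"
    using assms by (intro smooth_fun_subset[OF W(2)] openin_Int) (auto dest: smooth_funD(1))
  with W assms that show thesis by blast
qed

lemma smooth_near_binop:
  assumes "smooth_near p f" "smooth_near p h"
  shows "smooth_near p (\<lambda>q. f q + h q)" "smooth_near p (\<lambda>q. f q * h q)"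
proof -
  obtain W where W: "p \<in> W" "smooth_fun W f"
    using assms(1) by (auto simp: smooth_near_def)
  obtain V where V: "smooth_fun V h" "p \<in> V" "V \<subseteq> W"
    using smooth_nearE[OF assms(2) smooth_funD(1)[OF W(2)] W(1)] .
  then have "smooth_fun V f"
    using smooth_fun_subset[OF W(2)] smooth_funD(1) by blast
  with V show "smooth_near p (\<lambda>q. f q + h q)" "smooth_near p (\<lambda>q. f q * h q)"
    by (auto intro: smooth_nearI smooth_fun_add smooth_fun_mult)
qed

lemma smooth_near_const: "smooth_near p f \<Longrightarrow> smooth_near p (\<lambda>q. c)"
  unfolding smooth_near_def using smooth_fun_const smooth_funD(1) by blast

section \<open>Tangent vectors as derivations\<close>

lemma tangent_spaceD:
  assumes "v \<in> tangent_space p"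
  shows tangent_add: "smooth_near p f \<Longrightarrow> smooth_near p h \<Longrightarrow> v (\<lambda>q. f q + h q) = v f + v h"
    and tangent_mult: "smooth_near p f \<Longrightarrow> smooth_near p h \<Longrightarrow>
      v (\<lambda>q. f q * h q) = v f * h p + f p * v h"
    and tangent_scale: "smooth_near p f \<Longrightarrow> v (\<lambda>q. c * f q) = c * v f"
    and tangent_local: "smooth_near p f \<Longrightarrow> smooth_near p h \<Longrightarrow> openin M W \<Longrightarrow> p \<in> W \<Longrightarrow>
      (\<And>q. q \<in> W \<Longrightarrow> f q = h q) \<Longrightarrow> v f = v h"
    and tangent_not_smooth: "\<not> smooth_near p f \<Longrightarrow> v f = 0"
proof -
  note D = assms[unfolded tangent_space_def mem_Collect_eq]
  note D1 = D[THEN conjunct1, rule_format, OF conjI] and D2 = D[THEN conjunct2, THEN conjunct1, rule_format]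
    and D3 = D[THEN conjunct2, THEN conjunct2, THEN conjunct1, rule_format]
    and D4 = D[THEN conjunct2, THEN conjunct2, THEN conjunct2, rule_format]
  show "smooth_near p f \<Longrightarrow> smooth_near p h \<Longrightarrow> v (\<lambda>q. f q + h q) = v f + v h"
    by (rule D1[THEN conjunct1])
  show "smooth_near p f \<Longrightarrow> smooth_near p h \<Longrightarrow> v (\<lambda>q. f q * h q) = v f * h p + f p * v h"
    by (rule D1[THEN conjunct2])
  show "smooth_near p f \<Longrightarrow> v (\<lambda>q. c * f q) = c * v f"
    by (rule D2)
  show "smooth_near p f \<Longrightarrow> smooth_near p h \<Longrightarrow> openin M W \<Longrightarrow> p \<in> W \<Longrightarrow>
      (\<And>q. q \<in> W \<Longrightarrow> f q = h q) \<Longrightarrow> v f = v h"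
    by (rule D3[of f h W]) simp
  show "\<not> smooth_near p f \<Longrightarrow> v f = 0"
    by (rule D4)
qed

lemma smooth_near_diff:
  assumes "smooth_near p f" "smooth_near p h"
  shows "smooth_near p (\<lambda>q. f q - h q)"
  using smooth_near_binop(1)[OF assms(1) smooth_near_binop(2)[OF smooth_near_const[OF assms(2)] assms(2)], of "- 1"]
  by simp

lemma tangent_diff:
  assumes "v \<in> tangent_space p" "smooth_near p f" "smooth_near p h"
  shows "v (\<lambda>q. f q - h q) = v f - v h"
proof -
  have "smooth_near p (\<lambda>q. - 1 * h q)"
    using assms by (intro smooth_near_binop smooth_near_const)
  then show ?thesis
    using tangent_add[OF assms(1,2), of "\<lambda>q. - 1 * h q"] tangent_scale[OF assms(1,3), of "- 1"] by simp
qed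

lemma subspace_tangent_space: "subspace (tangent_space p)"
proof (rule subspaceI)
  show "0 \<in> tangent_space p"
    by (simp add: tangent_space_def)
  fix u v c assume u: "u \<in> tangent_space p"
  show "c *\<^sub>R u \<in> tangent_space p"
    unfolding tangent_space_def mem_Collect_eq scaleR_fun_def real_scaleR_def
  proof (intro conjI allI impI)
    fix f h W assume "smooth_near p f \<and> smooth_near p h \<and> openin M W \<and> p \<in> W \<and> (\<forall>q\<in>W. f q = h q)"
    then have "u f = u h" using tangent_local[OF u] by metis
    then show "c * u f = c * u h" by simp
  qed (simp_all add: tangent_spaceD(1-3,5)[OF u] algebra_simps)
  assume v: "v \<in> tangent_space p"
  show "u + v \<in> tangent_space p"
    unfolding tangent_space_def mem_Collect_eq plus_fun_apply
  proof (intro conjI allI impI)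
    fix f h W assume "smooth_near p f \<and> smooth_near p h \<and> openin M W \<and> p \<in> W \<and> (\<forall>q\<in>W. f q = h q)"
    then have "u f = u h" "v f = v h" using tangent_local[OF u] tangent_local[OF v] by metis+
    then show "u f + v f = u h + v h" by simp
  qed (simp_all add: tangent_spaceD(1-3,5)[OF u] tangent_spaceD(1-3,5)[OF v] algebra_simps)
qed

section \<open>Vector fields as a module over smooth functions\<close>

lemma vector_field_openin: "vector_field U X \<Longrightarrow> openin M U"
  by (simp add: vector_field_def)

lemma vector_field_tangent: "vector_field U X \<Longrightarrow> p \<in> U \<Longrightarrow> X p \<in> tangent_space p"
  by (simp add: vector_field_def)

lemma vector_field_smooth_fun:
  "vector_field U X \<Longrightarrow> W \<subseteq> U \<Longrightarrow> smooth_fun W f \<Longrightarrow> smooth_fun W (\<lambda>p. X p f)"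
  by (simp add: vector_field_def)

lemma vector_field_subset: "vector_field U X \<Longrightarrow> V \<subseteq> U \<Longrightarrow> openin M V \<Longrightarrow> vector_field V X"
  unfolding vector_field_def by blast

lemma vector_field_smooth_near:
  assumes "vector_field U X" "p \<in> U" "smooth_near p f"
  shows "smooth_near p (\<lambda>q. X q f)"
proof -
  obtain W where "smooth_fun W f" "p \<in> W" "W \<subseteq> U"
    using smooth_nearE[OF assms(3) vector_field_openin[OF assms(1)] assms(2)] .
  then show ?thesis
    using vector_field_smooth_fun[OF assms(1)] smooth_nearI by blast
qed

lemma vector_field_add:
  "vector_field U X \<Longrightarrow> vector_field U Y \<Longrightarrow> vector_field U (\<lambda>q. X q + Y q)"
  by (simp add: vector_field_def smooth_fun_add subspace_add[OF subspace_tangent_space])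

lemma vector_field_scale:
  assumes f: "smooth_fun U f" and X: "vector_field U X"
  shows "vector_field U (\<lambda>q. f q *\<^sub>R X q)"
  unfolding vector_field_def
proof (intro conjI ballI allI impI)
  show "openin M U" by (rule smooth_funD(1)[OF f])
  show "f p *\<^sub>R X p \<in> tangent_space p" if "p \<in> U" for p
    by (rule subspace_scale[OF subspace_tangent_space vector_field_tangent[OF X that]])
  fix W h assume W: "W \<subseteq> U \<and> smooth_fun W h"
  then have "smooth_fun W f" "smooth_fun W (\<lambda>p. X p h)"
    using smooth_fun_subset[OF f] smooth_funD(1) vector_field_smooth_fun[OF X] by blast+
  then show "smooth_fun W (\<lambda>p. (f p *\<^sub>R X p) h)"
    by (simp add: scaleR_fun_def smooth_fun_mult)
qed

lemma vector_field_diff: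
  assumes "vector_field U X" "vector_field U Y"
  shows "vector_field U (\<lambda>q. X q - Y q)"
proof -
  have "vector_field U (\<lambda>q. X q + (- 1) *\<^sub>R Y q)"
    using assms by (simp only: vector_field_add vector_field_scale smooth_fun_const vector_field_openin)
  then show ?thesis by simp
qed

lemma vector_field_zero: "openin M U \<Longrightarrow> vector_field U (\<lambda>q. 0)"
  using subspace_0[OF subspace_tangent_space] smooth_fun_const smooth_funD(1)
  unfolding vector_field_def zero_fun_apply by blast

lemma vector_field_sum:
  assumes "finite I" "openin M U" "\<And>i. i \<in> I \<Longrightarrow> smooth_fun U (f i)" "\<And>i. i \<in> I \<Longrightarrow> vector_field U (X i)"
  shows "vector_field U (\<lambda>q. \<Sum>i\<in>I. f i q *\<^sub>R X i q)"
  using assms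
proof (induction I)
  case empty
  then show ?case by (simp only: sum.empty vector_field_zero)
next
  case (insert i I)
  then show ?case by (simp only: sum.insert vector_field_add vector_field_scale insert_iff simp_thms)
qed

end

section \<open>Orthonormal frames\<close>

context riemannian_manifold
begin

lemma metric_left:
  assumes "p \<in> topspace M" "u \<in> tangent_space p" "v \<in> tangent_space p" "w \<in> tangent_space p"
  shows metric_add_left: "g p (u + v) w = g p u w + g p v w"
    and metric_scale_left: "g p (c *\<^sub>R u) w = c * g p u w"
    and metric_diff_left: "g p (u - v) w = g p u w - g p v w"
  using metric_linear[OF assms, of 1 1] metric_linear[OF assms, of c 0] metric_linear[OF assms, of 1 "- 1"]
  by simp_all

lemma metric_sum_left:
  assumes "finite I" "p \<in> topspace M" "w \<in> tangent_space p" "\<And>i. i \<in> I \<Longrightarrow> u i \<in> tangent_space p"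
  shows "g p (\<Sum>i\<in>I. c i *\<^sub>R u i) w = (\<Sum>i\<in>I. c i * g p (u i) w)"
  using assms
proof (induction I)
  case empty
  have "g p (0 *\<^sub>R 0) w = 0 * g p 0 w"
    using empty.prems by (intro metric_scale_left subspace_0 subspace_tangent_space)
  then show ?case by (simp only: sum.empty scaleR_zero_left mult_zero_left)
next
  case (insert i I)
  have "c i *\<^sub>R u i \<in> tangent_space p" "(\<Sum>i\<in>I. c i *\<^sub>R u i) \<in> tangent_space p"
    using insert.prems by (simp_all add: subspace_sum subspace_scale subspace_tangent_space)
  then have "g p (c i *\<^sub>R u i + (\<Sum>i\<in>I. c i *\<^sub>R u i)) w = c i * g p (u i) w + g p (\<Sum>i\<in>I. c i *\<^sub>R u i) w"
    using insert.prems by (simp add: metric_add_left metric_scale_left)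
  then show ?case
    using insert by (simp only: sum.insert insert_iff simp_thms)
qed

lemma orthonormal_basis_tangent: "orthonormal_basis p e \<Longrightarrow> e i \<in> tangent_space p"
  unfolding orthonormal_basis_def using span_base[of "e i" "range e"] by auto

lemma orthonormal_basis_inner: "orthonormal_basis p e \<Longrightarrow> g p (e i) (e j) = (if i = j then 1 else 0)"
  unfolding orthonormal_basis_def by blast

lemma orthonormal_expansion:
  fixes e :: "'n \<Rightarrow> 'a tvec"
  assumes e: "orthonormal_basis p e" and p: "p \<in> topspace M" and x: "x \<in> tangent_space p"
  shows "x = (\<Sum>i\<in>UNIV. g p x (e i) *\<^sub>R e i)"
proof -
  \<comment> \<open>Injectivity turns the sum over the set \<open>range e\<close>, given by the
    span, into a sum over indices.\<close>
  have "inj e"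
    using orthonormal_basis_inner[OF e] by (intro injI) (metis zero_neq_one)
  have "x \<in> span (range e)"
    using e x by (simp add: orthonormal_basis_def)
  then obtain c where "x = (\<Sum>v\<in>range e. c v *\<^sub>R v)"
    by (auto simp: span_finite)
  then have c: "x = (\<Sum>i\<in>UNIV. c (e i) *\<^sub>R e i)"
    by (simp only: sum.reindex[OF \<open>inj e\<close>] o_def)
  have "g p x (e j) = c (e j)" for j
  proof -
    have "g p x (e j) = (\<Sum>i\<in>UNIV. c (e i) * g p (e i) (e j))"
      by (subst c, rule metric_sum_left) (simp_all add: p orthonormal_basis_tangent[OF e])
    then show ?thesis
      by (simp add: orthonormal_basis_inner[OF e] mult_delta_right)
  qed
  with c show ?thesis by simp
qed

text \<open>\<open>trace_on\<close> chooses an arbitrary basis \<open>B\<close>. Expanding each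
  \<open>b\<close> in the orthonormal basis and exchanging the two sums reassembles
  \<open>L (e i)\<close> from its coordinates in \<open>B\<close>. Linearity of \<open>L\<close> is
  assumed in exactly the form that \<open>curv_expansion\<close> provides.\<close>

lemma trace_on_orthonormal:
  fixes e :: "'n \<Rightarrow> 'a tvec"
  assumes e: "orthonormal_basis p e" and p: "p \<in> topspace M"
    and L: "\<And>x. x \<in> tangent_space p \<Longrightarrow> L x = (\<Sum>i\<in>UNIV. g p x (e i) *\<^sub>R L (e i))"
    and LT: "\<And>i. L (e i) \<in> tangent_space p"
  shows "trace_on (tangent_space p) L = (\<Sum>i\<in>UNIV. g p (L (e i)) (e i))"
proof -
  let ?T = "tangent_space p"
  define B where "B = (SOME B. independent B \<and> span B = ?T)"
  obtain B0 where "independent B0" "span B0 = ?T"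
    using maximal_independent_subset[of ?T] span_subspace[OF _ _ subspace_tangent_space]
    by metis
  then have B: "independent B" "span B = ?T"
    unfolding B_def by (metis (mono_tags, lifting) someI)+
  have BT: "b \<in> ?T" if "b \<in> B" for b
    using B(2) that span_base by blast
  have "B \<subseteq> span (range e)"
    using BT e by (auto simp: orthonormal_basis_def)
  then have fin: "finite B"
    using independent_span_bound[OF _ B(1), of "range e"] by simp
  have "representation B (L b) b = (\<Sum>i\<in>UNIV. g p b (e i) * representation B (L (e i)) b)" if "b \<in> B" for b
  proof -
    have "representation B (L b) = representation B (\<Sum>i\<in>UNIV. g p b (e i) *\<^sub>R L (e i))"
      using L[OF BT[OF that]] by metis
    also have "\<dots> = (\<lambda>b'. \<Sum>i\<in>UNIV. representation B (g p b (e i) *\<^sub>R L (e i)) b')"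
      using B LT by (intro representation_sum) (auto intro: span_scale)
    finally show ?thesis
      using B LT by (simp add: representation_scale)
  qed
  then have "trace_on ?T L = (\<Sum>b\<in>B. \<Sum>i\<in>UNIV. g p b (e i) * representation B (L (e i)) b)"
    by (simp add: trace_on_def B_def[symmetric])
  also have "\<dots> = (\<Sum>i\<in>UNIV. \<Sum>b\<in>B. representation B (L (e i)) b * g p b (e i))"
    by (subst sum.swap) (simp add: mult.commute)
  also have "\<dots> = (\<Sum>i\<in>UNIV. g p (L (e i)) (e i))"
  proof (intro sum.cong refl)
    fix i
    have "g p (\<Sum>b\<in>B. representation B (L (e i)) b *\<^sub>R b) (e i)
        = (\<Sum>b\<in>B. representation B (L (e i)) b * g p b (e i))"
      by (rule metric_sum_left) (simp_all add: fin p BT orthonormal_basis_tangent[OF e])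
    moreover have "(\<Sum>b\<in>B. representation B (L (e i)) b *\<^sub>R b) = L (e i)"
      using B LT fin by (intro sum_representation_eq) auto
    ultimately show "(\<Sum>b\<in>B. representation B (L (e i)) b * g p b (e i)) = g p (L (e i)) (e i)"
      by simp
  qed
  finally show ?thesis .
qed

lemma orthonormal_frameD:
  assumes "orthonormal_frame U E"
  shows "openin M U" "vector_field U (E i)" "p \<in> U \<Longrightarrow> orthonormal_basis p (\<lambda>i. E i p)"
    "p \<in> U \<Longrightarrow> p \<in> topspace M"
  using assms openin_subset[of M U] unfolding orthonormal_frame_def by auto

lemma orthonormal_frame_subset:
  "orthonormal_frame U E \<Longrightarrow> V \<subseteq> U \<Longrightarrow> openin M V \<Longrightarrow> orthonormal_frame V E"
  unfolding orthonormal_frame_def using vector_field_subset by blast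

text \<open>On the frame's domain a field equals its expansion with smooth coefficients, so
  additivity and linearity over smooth functions make \<open>T X\<close> depend on
  \<open>X p\<close> alone, with no cut-off argument.\<close>

lemma tensorial_expansion:
  fixes T :: "('a \<Rightarrow> 'a tvec) \<Rightarrow> 'v::real_vector"
  assumes E: "orthonormal_frame U E" and p: "p \<in> U" and X: "vector_field U X"
    and add: "\<And>X Y. vector_field U X \<Longrightarrow> vector_field U Y \<Longrightarrow> T (\<lambda>q. X q + Y q) = T X + T Y"
    and scale: "\<And>f X. smooth_fun U f \<Longrightarrow> vector_field U X \<Longrightarrow> T (\<lambda>q. f q *\<^sub>R X q) = f p *\<^sub>R T X"
    and cong: "\<And>X Y. vector_field U X \<Longrightarrow> vector_field U Y \<Longrightarrow> (\<And>q. q \<in> U \<Longrightarrow> X q = Y q) \<Longrightarrow> T X = T Y"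
  shows "T X = (\<Sum>i\<in>UNIV. g p (X p) (E i p) *\<^sub>R T (E i))"
proof -
  note frame = orthonormal_frameD[OF E]
  let ?f = "\<lambda>i q. g q (X q) (E i q)"
  have f: "smooth_fun U (?f i)" for i
    using metric_smooth X frame(2) by blast
  have *: "T (\<lambda>q. \<Sum>i\<in>I. ?f i q *\<^sub>R E i q) = (\<Sum>i\<in>I. ?f i p *\<^sub>R T (E i))" if "finite I" for I
    using that
  proof induction
    case empty
    have "T (\<lambda>q. 0 *\<^sub>R X q) = 0 *\<^sub>R T X"
      using scale[OF smooth_fun_const[OF frame(1)] X] .
    then show ?case by (simp only: scaleR_zero_left sum.empty)
  next
    case (insert i I)
    have "vector_field U (\<lambda>q. ?f i q *\<^sub>R E i q)" "vector_field U (\<lambda>q. \<Sum>i\<in>I. ?f i q *\<^sub>R E i q)"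
      using vector_field_scale[OF f frame(2)] vector_field_sum[OF insert.hyps(1) frame(1) f frame(2)] .
    then show ?case
      using insert by (simp only: sum.insert add scale[OF f frame(2)] simp_thms)
  qed
  have "T X = T (\<lambda>q. \<Sum>i\<in>UNIV. ?f i q *\<^sub>R E i q)"
  proof (rule cong[OF X])
    show "vector_field U (\<lambda>q. \<Sum>i\<in>UNIV. ?f i q *\<^sub>R E i q)"
      by (rule vector_field_sum[OF finite frame(1) f frame(2)])
    show "X q = (\<Sum>i\<in>UNIV. ?f i q *\<^sub>R E i q)" if "q \<in> U" for q
      using orthonormal_expansion[OF frame(3)[OF that] frame(4)[OF that] vector_field_tangent[OF X that]] .
  qed
  with * show ?thesis by simp
qed

end

section \<open>The curvature tensor\<close>

context levi_civita_manifold
begin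

section \<open>Covariant derivatives and brackets\<close>

lemma cov_vector_field: "vector_field U X \<Longrightarrow> vector_field U Y \<Longrightarrow> vector_field U (cov X Y)"
  unfolding cov_def by (rule conn_smooth)

lemma conn_direction:
  assumes "vector_field U Y" "p \<in> U" "v \<in> tangent_space p" "w \<in> tangent_space p"
  shows conn_add_direction: "nabla p (v + w) Y = nabla p v Y + nabla p w Y"
    and conn_diff_direction: "nabla p (v - w) Y = nabla p v Y - nabla p w Y"
    and conn_scale_direction: "nabla p (c *\<^sub>R v) Y = c *\<^sub>R nabla p v Y"
  using conn_linear[OF assms, of 1 1] conn_linear[OF assms, of 1 "- 1"] conn_linear[OF assms, of c 0]
  by (simp_all only: scaleR_one scaleR_minus_left add_uminus_conv_diff scaleR_zero_left add_0_right)

text \<open>Vanishing torsion expresses the bracket through smooth fields, so that its tangency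
  needs no computation with derivations.\<close>

lemma lie_bracket_eq:
  "vector_field U X \<Longrightarrow> vector_field U Y \<Longrightarrow> p \<in> U \<Longrightarrow> lie_bracket X Y p = cov X Y p - cov Y X p"
  unfolding cov_def using torsion_free by metis

lemma lie_bracket_tangent:
  "vector_field U X \<Longrightarrow> vector_field U Y \<Longrightarrow> p \<in> U \<Longrightarrow> lie_bracket X Y p \<in> tangent_space p"
  by (simp only: lie_bracket_eq subspace_diff[OF subspace_tangent_space] vector_field_tangent[OF cov_vector_field])

context
  fixes U :: "'a set" and p :: 'a and X Y Z :: "'a \<Rightarrow> 'a tvec"
  assumes X: "vector_field U X" and Y: "vector_field U Y" and Z: "vector_field U Z" and p: "p \<in> U"
begin

text \<open>With the bracket split, each term is a covariant derivative of a field known to be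
  smooth on \<open>U\<close>, to which the connection axioms apply directly.\<close>

lemma curvature_eq:
  "curvature X Y Z p = nabla p (X p) (cov Y Z) - nabla p (Y p) (cov X Z)
     - (nabla p (cov X Y p) Z - nabla p (cov Y X p) Z)"
  unfolding curvature_def cov_def[of "lie_bracket X Y"] lie_bracket_eq[OF X Y p]
  by (simp only: conn_diff_direction[OF Z p] vector_field_tangent[OF cov_vector_field[OF X Y] p]
      vector_field_tangent[OF cov_vector_field[OF Y X] p] cov_def[of X "cov Y Z"] cov_def[of Y "cov X Z"])

lemma curvature_tangent: "curvature X Y Z p \<in> tangent_space p"
proof -
  have "cov (lie_bracket X Y) Z p \<in> tangent_space p"
    unfolding cov_def[of "lie_bracket X Y"]
    by (rule conn_tangent[OF Z p lie_bracket_tangent[OF X Y p]])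
  then show ?thesis
    unfolding curvature_def
    by (intro subspace_diff[OF subspace_tangent_space])
      (assumption | rule vector_field_tangent[OF cov_vector_field p] cov_vector_field X Y Z)+
qed

end

section \<open>Tensoriality and symmetries of the curvature\<close>

lemma curvature_swap:
  assumes "vector_field U X" "vector_field U Y" "vector_field U Z" "p \<in> U"
  shows "curvature Y X Z p = - curvature X Y Z p"
  by (simp only: curvature_eq[of U] assms) simp

lemma curvature_cong1:
  assumes X: "vector_field U X" and X': "vector_field U X'" and Y: "vector_field U Y"
    and Z: "vector_field U Z" and p: "p \<in> U" and eq: "\<And>q. q \<in> U \<Longrightarrow> X q = X' q"
  shows "curvature X Y Z p = curvature X' Y Z p"
proof -
  have c: "cov X V q = cov X' V q" if "q \<in> U" for V q
    using eq[OF that] by (simp only: cov_def)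
  have "nabla p (Y p) (cov X Z) = nabla p (Y p) (cov X' Z)"
    by (rule conn_local[OF cov_vector_field[OF X Z] cov_vector_field[OF X' Z] p vector_field_tangent[OF Y p] c])
  moreover have "cov Y X p = cov Y X' p"
    unfolding cov_def by (rule conn_local[OF X X' p vector_field_tangent[OF Y p] eq])
  ultimately show ?thesis
    by (simp only: curvature_eq[OF X Y Z p] curvature_eq[OF X' Y Z p] c[OF p] eq[OF p])
qed

lemma curvature_cong3:
  assumes X: "vector_field U X" and Y: "vector_field U Y" and Z: "vector_field U Z"
    and Z': "vector_field U Z'" and p: "p \<in> U" and eq: "\<And>q. q \<in> U \<Longrightarrow> Z q = Z' q"
  shows "curvature X Y Z p = curvature X Y Z' p"
proof -
  have c: "nabla q v Z = nabla q v Z'" if "q \<in> U" "v \<in> tangent_space q" for q v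
    by (rule conn_local[OF Z Z' that eq])
  have d: "nabla p v (cov V Z) = nabla p v (cov V Z')" if V: "vector_field U V" and v: "v \<in> tangent_space p" for v V
    by (rule conn_local[OF cov_vector_field[OF V Z] cov_vector_field[OF V Z'] p v])
      (simp only: cov_def c vector_field_tangent[OF V])
  show ?thesis
    by (simp only: curvature_eq[OF X Y Z p] curvature_eq[OF X Y Z' p] c[OF p] d X Y
        vector_field_tangent[OF X p] vector_field_tangent[OF Y p]
        vector_field_tangent[OF cov_vector_field p])
qed

lemma curvature_add1:
  assumes X: "vector_field U X" and X': "vector_field U X'" and Y: "vector_field U Y"
    and Z: "vector_field U Z" and p: "p \<in> U"
  shows "curvature (\<lambda>q. X q + X' q) Y Z p = curvature X Y Z p + curvature X' Y Z p"
proof -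
  let ?X = "\<lambda>q. X q + X' q"
  have vX: "vector_field U ?X"
    by (rule vector_field_add[OF X X'])
  have c: "cov ?X V q = cov X V q + cov X' V q" if "vector_field U V" "q \<in> U" for V q
    unfolding cov_def
    by (rule conn_add_direction[OF that vector_field_tangent[OF X that(2)] vector_field_tangent[OF X' that(2)]])
  have "nabla p (Y p) (cov ?X Z) = nabla p (Y p) (\<lambda>q. cov X Z q + cov X' Z q)"
    by (rule conn_local[OF cov_vector_field[OF vX Z] vector_field_add p vector_field_tangent[OF Y p] c[OF Z]])
      (rule cov_vector_field[OF X Z] cov_vector_field[OF X' Z])+
  also have "\<dots> = nabla p (Y p) (cov X Z) + nabla p (Y p) (cov X' Z)"
    by (rule conn_add[OF cov_vector_field[OF X Z] cov_vector_field[OF X' Z] p vector_field_tangent[OF Y p]])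
  finally have 1: "nabla p (Y p) (cov ?X Z) = nabla p (Y p) (cov X Z) + nabla p (Y p) (cov X' Z)" .
  have 2: "cov Y ?X p = cov Y X p + cov Y X' p"
    unfolding cov_def by (rule conn_add[OF X X' p vector_field_tangent[OF Y p]])
  show ?thesis
    unfolding curvature_eq[OF vX Y Z p] curvature_eq[OF X Y Z p] curvature_eq[OF X' Y Z p] 1 2 c[OF Y p]
    by (simp only: conn_add_direction[OF Z p] conn_add_direction[OF cov_vector_field[OF Y Z] p]
        vector_field_tangent[OF cov_vector_field p] vector_field_tangent[OF X p]
        vector_field_tangent[OF X' p] X X' Y) (simp only: algebra_simps)
qed

text \<open>The derivative of \<open>f\<close> along \<open>Y\<close> enters twice, from
  differentiating \<open>cov ?X Z\<close> and from the direction \<open>cov Y ?X p\<close>, with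
  opposite signs.\<close>

lemma curvature_scale1:
  assumes f: "smooth_fun U f" and X: "vector_field U X" and Y: "vector_field U Y"
    and Z: "vector_field U Z" and p: "p \<in> U"
  shows "curvature (\<lambda>q. f q *\<^sub>R X q) Y Z p = f p *\<^sub>R curvature X Y Z p"
proof -
  let ?X = "\<lambda>q. f q *\<^sub>R X q"
  have vX: "vector_field U ?X"
    by (rule vector_field_scale[OF f X])
  have Yp: "Y p \<in> tangent_space p" and Xp: "X p \<in> tangent_space p"
    by (rule vector_field_tangent[OF Y p] vector_field_tangent[OF X p])+
  have c: "cov ?X V q = f q *\<^sub>R cov X V q" if "vector_field U V" "q \<in> U" for V q
    unfolding cov_def
    by (rule conn_scale_direction[OF that vector_field_tangent[OF X that(2)] vector_field_tangent[OF X that(2)]])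
  have "nabla p (Y p) (cov ?X Z) = nabla p (Y p) (\<lambda>q. f q *\<^sub>R cov X Z q)"
    by (rule conn_local[OF cov_vector_field[OF vX Z] vector_field_scale[OF f cov_vector_field[OF X Z]] p Yp c[OF Z]])
  also have "\<dots> = Y p f *\<^sub>R cov X Z p + f p *\<^sub>R nabla p (Y p) (cov X Z)"
    by (rule conn_Leibniz[OF f cov_vector_field[OF X Z] p Yp])
  finally have 1: "nabla p (Y p) (cov ?X Z) = Y p f *\<^sub>R cov X Z p + f p *\<^sub>R nabla p (Y p) (cov X Z)" .
  have 2: "cov Y ?X p = Y p f *\<^sub>R X p + f p *\<^sub>R cov Y X p"
    unfolding cov_def by (rule conn_Leibniz[OF f X p Yp])
  have t: "cov Y X p \<in> tangent_space p" "cov X Y p \<in> tangent_space p"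
    by (rule vector_field_tangent[OF cov_vector_field p] X Y)+
  have 3: "nabla p (cov Y ?X p) Z = Y p f *\<^sub>R cov X Z p + f p *\<^sub>R nabla p (cov Y X p) Z"
    unfolding 2 cov_def[of X Z] by (rule conn_linear[OF Z p Xp t(1)])
  have 4: "nabla p (cov ?X Y p) Z = f p *\<^sub>R nabla p (cov X Y p) Z"
    unfolding c[OF Y p] by (rule conn_scale_direction[OF Z p t(2) t(2)])
  have 5: "nabla p (?X p) (cov Y Z) = f p *\<^sub>R nabla p (X p) (cov Y Z)"
    by (rule conn_scale_direction[OF cov_vector_field[OF Y Z] p Xp Xp])
  show ?thesis
    unfolding curvature_eq[OF vX Y Z p] curvature_eq[OF X Y Z p] 1 3 4 5
    by (simp only: algebra_simps)
qed

lemma curvature_add3: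
  assumes X: "vector_field U X" and Y: "vector_field U Y" and Z: "vector_field U Z"
    and Z': "vector_field U Z'" and p: "p \<in> U"
  shows "curvature X Y (\<lambda>q. Z q + Z' q) p = curvature X Y Z p + curvature X Y Z' p"
proof -
  let ?Z = "\<lambda>q. Z q + Z' q"
  have vZ: "vector_field U ?Z"
    by (rule vector_field_add[OF Z Z'])
  have c: "nabla q v ?Z = nabla q v Z + nabla q v Z'" if "q \<in> U" "v \<in> tangent_space q" for q v
    by (rule conn_add[OF Z Z' that])
  have d: "nabla p v (cov V ?Z) = nabla p v (cov V Z) + nabla p v (cov V Z')"
    if V: "vector_field U V" and v: "v \<in> tangent_space p" for v V
  proof -
    have "nabla p v (cov V ?Z) = nabla p v (\<lambda>q. cov V Z q + cov V Z' q)"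
      by (rule conn_local[OF cov_vector_field[OF V vZ]
            vector_field_add[OF cov_vector_field[OF V Z] cov_vector_field[OF V Z']] p v])
        (simp only: cov_def c vector_field_tangent[OF V])
    also have "\<dots> = nabla p v (cov V Z) + nabla p v (cov V Z')"
      by (rule conn_add[OF cov_vector_field[OF V Z] cov_vector_field[OF V Z'] p v])
    finally show ?thesis .
  qed
  show ?thesis
    by (simp only: curvature_eq[OF X Y vZ p] curvature_eq[OF X Y Z p] curvature_eq[OF X Y Z' p]
        c[OF p] d X Y vector_field_tangent[OF X p] vector_field_tangent[OF Y p]
        vector_field_tangent[OF cov_vector_field p]) (simp only: algebra_simps)
qed

text \<open>First-order terms in \<open>f\<close> cancel in pairs; the second derivatives combine to
  the commutator of \<open>X\<close> and \<open>Y\<close> on \<open>f\<close>, which the bracket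
  term removes.\<close>

lemma curvature_scale3:
  assumes f: "smooth_fun U f" and X: "vector_field U X" and Y: "vector_field U Y"
    and Z: "vector_field U Z" and p: "p \<in> U"
  shows "curvature X Y (\<lambda>q. f q *\<^sub>R Z q) p = f p *\<^sub>R curvature X Y Z p"
proof -
  let ?Z = "\<lambda>q. f q *\<^sub>R Z q"
  have vZ: "vector_field U ?Z"
    by (rule vector_field_scale[OF f Z])
  have c: "nabla q v ?Z = v f *\<^sub>R Z q + f q *\<^sub>R nabla q v Z" if "q \<in> U" "v \<in> tangent_space q" for q v
    by (rule conn_Leibniz[OF f Z that])
  have d: "cov V (cov W ?Z) p = V p (\<lambda>q. W q f) *\<^sub>R Z p + W p f *\<^sub>R cov V Z p
      + (V p f *\<^sub>R cov W Z p + f p *\<^sub>R cov V (cov W Z) p)"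
    if V: "vector_field U V" and W: "vector_field U W" for V W
  proof -
    note Vp = vector_field_tangent[OF V p]
    have Wf: "smooth_fun U (\<lambda>q. W q f)"
      by (rule vector_field_smooth_fun[OF W order_refl f])
    have v1: "vector_field U (\<lambda>q. W q f *\<^sub>R Z q)" and v2: "vector_field U (\<lambda>q. f q *\<^sub>R cov W Z q)"
      by (rule vector_field_scale[OF Wf Z] vector_field_scale[OF f cov_vector_field[OF W Z]])+
    have "nabla p (V p) (cov W ?Z) = nabla p (V p) (\<lambda>q. W q f *\<^sub>R Z q + f q *\<^sub>R cov W Z q)"
      by (rule conn_local[OF cov_vector_field[OF W vZ] vector_field_add[OF v1 v2] p Vp])
        (simp only: cov_def c vector_field_tangent[OF W])
    also have "\<dots> = nabla p (V p) (\<lambda>q. W q f *\<^sub>R Z q) + nabla p (V p) (\<lambda>q. f q *\<^sub>R cov W Z q)"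
      by (rule conn_add[OF v1 v2 p Vp])
    also have "nabla p (V p) (\<lambda>q. W q f *\<^sub>R Z q) = V p (\<lambda>q. W q f) *\<^sub>R Z p + W p f *\<^sub>R nabla p (V p) Z"
      by (rule conn_Leibniz[OF Wf Z p Vp])
    also have "nabla p (V p) (\<lambda>q. f q *\<^sub>R cov W Z q) = V p f *\<^sub>R cov W Z p + f p *\<^sub>R nabla p (V p) (cov W Z)"
      by (rule conn_Leibniz[OF f cov_vector_field[OF W Z] p Vp])
    finally show ?thesis
      by (simp only: cov_def)
  qed
  have e: "cov (lie_bracket X Y) ?Z p
      = (X p (\<lambda>q. Y q f) - Y p (\<lambda>q. X q f)) *\<^sub>R Z p + f p *\<^sub>R cov (lie_bracket X Y) Z p"
  proof -
    have "lie_bracket X Y p f = X p (\<lambda>q. Y q f) - Y p (\<lambda>q. X q f)"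
      using smooth_nearI[OF f p] by (simp add: lie_bracket_def)
    then show ?thesis
      unfolding cov_def[of "lie_bracket X Y"] using c[OF p lie_bracket_tangent[OF X Y p]] by simp
  qed
  show ?thesis
    unfolding curvature_def d[OF X Y] d[OF Y X] e
    by (simp only: algebra_simps)
qed

text \<open>Regrouping the nine terms by their outer derivative and using vanishing torsion twice
  yields the three double brackets of the Jacobi identity.\<close>

lemma curvature_bianchi:
  assumes X: "vector_field U X" and Y: "vector_field U Y" and Z: "vector_field U Z" and p: "p \<in> U"
  shows "curvature X Y Z p + curvature Y Z X p + curvature Z X Y p = 0"
proof -
  \<comment> \<open>\<open>V X Y\<close> agrees with the bracket on \<open>U\<close> and is a vector
    field by construction, so it can itself be differentiated and bracketed.\<close>
  define V where "V X Y = (\<lambda>q. cov X Y q - cov Y X q)" for X Y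
  have V: "vector_field U (V X Y)" if "vector_field U X" "vector_field U Y" for X Y
    unfolding V_def by (rule vector_field_diff[OF cov_vector_field[OF that] cov_vector_field[OF that(2,1)]])
  have VL: "V X Y q = lie_bracket X Y q" if "vector_field U X" "vector_field U Y" "q \<in> U" for X Y q
    using lie_bracket_eq[OF that] by (simp only: V_def)
  have bracket: "cov X (cov Y Z) p - cov X (cov Z Y) p - cov (lie_bracket Y Z) X p = lie_bracket X (V Y Z) p"
    if X: "vector_field U X" and Y: "vector_field U Y" and Z: "vector_field U Z" for X Y Z
  proof -
    note Xp = vector_field_tangent[OF X p]
    have "cov X (cov Y Z) p = nabla p (X p) (\<lambda>q. V Y Z q + cov Z Y q)"
      unfolding cov_def[of X "cov Y Z"]
      by (rule conn_local[OF cov_vector_field[OF Y Z] vector_field_add[OF V[OF Y Z] cov_vector_field[OF Z Y]] p Xp])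
        (simp only: V_def diff_add_cancel)
    also have "\<dots> = nabla p (X p) (V Y Z) + nabla p (X p) (cov Z Y)"
      by (rule conn_add[OF V[OF Y Z] cov_vector_field[OF Z Y] p Xp])
    finally have "cov X (cov Y Z) p - cov X (cov Z Y) p = cov X (V Y Z) p"
      by (simp only: cov_def add_diff_cancel)
    moreover have "cov (lie_bracket Y Z) X p = cov (V Y Z) X p"
      by (simp only: cov_def VL[OF Y Z p])
    ultimately show ?thesis
      using lie_bracket_eq[OF X V[OF Y Z] p] by simp
  qed
  have jacobi: "lie_bracket X (V Y Z) p + lie_bracket Y (V Z X) p + lie_bracket Z (V X Y) p = 0"
  proof
    fix f
    show "(lie_bracket X (V Y Z) p + lie_bracket Y (V Z X) p + lie_bracket Z (V X Y) p) f = 0 f"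
    proof (cases "smooth_near p f")
      case True
      obtain W where W: "smooth_fun W f" "p \<in> W" "W \<subseteq> U"
        using smooth_nearE[OF True vector_field_openin[OF X] p] .
      have L: "lie_bracket X (V Y Z) p f
          = X p (\<lambda>q. Y q (\<lambda>r. Z r f)) - X p (\<lambda>q. Z q (\<lambda>r. Y r f))
            - (Y p (\<lambda>q. Z q (\<lambda>r. X r f)) - Z p (\<lambda>q. Y q (\<lambda>r. X r f)))"
        if X: "vector_field U X" and Y: "vector_field U Y" and Z: "vector_field U Z" for X Y Z
      proof -
        note Xp = vector_field_tangent[OF X p]
        have n: "smooth_near p (\<lambda>q. F q (\<lambda>r. G r f))" if "vector_field U F" "vector_field U G" for F G
          by (rule vector_field_smooth_near[OF that(1) p vector_field_smooth_near[OF that(2) p True]])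
        \<comment> \<open>Only for \<open>q\<close> in \<open>W\<close> is \<open>f\<close> known to
          be smooth near \<open>q\<close>; elsewhere the bracket may take its default value
          0.\<close>
        have "V Y Z q f = Y q (\<lambda>r. Z r f) - Z q (\<lambda>r. Y r f)" if "q \<in> W" for q
          using VL[OF Y Z] W(3) that smooth_nearI[OF W(1) that] by (auto simp: lie_bracket_def)
        then have "X p (\<lambda>q. V Y Z q f) = X p (\<lambda>q. Y q (\<lambda>r. Z r f) - Z q (\<lambda>r. Y r f))"
          by (intro tangent_local[OF Xp vector_field_smooth_near[OF V[OF Y Z] p True] _ smooth_funD(1)[OF W(1)] W(2)]
              smooth_near_diff n Y Z)
        also have "\<dots> = X p (\<lambda>q. Y q (\<lambda>r. Z r f)) - X p (\<lambda>q. Z q (\<lambda>r. Y r f))"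
          by (rule tangent_diff[OF Xp n[OF Y Z] n[OF Z Y]])
        finally have 1: "X p (\<lambda>q. V Y Z q f) = X p (\<lambda>q. Y q (\<lambda>r. Z r f)) - X p (\<lambda>q. Z q (\<lambda>r. Y r f))" .
        have 2: "V Y Z p (\<lambda>q. X q f) = Y p (\<lambda>q. Z q (\<lambda>r. X r f)) - Z p (\<lambda>q. Y q (\<lambda>r. X r f))"
          using VL[OF Y Z p] vector_field_smooth_near[OF X p True] by (simp add: lie_bracket_def)
        show ?thesis
          using True by (simp add: lie_bracket_def 1 2)
      qed
      show ?thesis
        unfolding plus_fun_apply L[OF X Y Z] L[OF Y Z X] L[OF Z X Y] by simp
    next
      case False
      then show ?thesis by (simp add: lie_bracket_def)
    qed
  qed
  have "curvature X Y Z p + curvature Y Z X p + curvature Z X Y p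
      = (cov X (cov Y Z) p - cov X (cov Z Y) p - cov (lie_bracket Y Z) X p)
      + (cov Y (cov Z X) p - cov Y (cov X Z) p - cov (lie_bracket Z X) Y p)
      + (cov Z (cov X Y) p - cov Z (cov Y X) p - cov (lie_bracket X Y) Z p)"
    unfolding curvature_def by (simp only: algebra_simps)
  then show ?thesis
    unfolding bracket[OF X Y Z] bracket[OF Y Z X] bracket[OF Z X Y] jacobi .
qed

text \<open>Apply the commutator of \<open>X\<close> and \<open>Y\<close> to the function
  \<open>g(Z, V)\<close>. Mixed products of first derivatives are symmetric in \<open>X\<close> and
  \<open>Y\<close> and cancel; comparison with the derivative along the bracket leaves the two
  curvature terms.\<close>

lemma curvature_skew:
  assumes X: "vector_field U X" and Y: "vector_field U Y" and Z: "vector_field U Z"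
    and V: "vector_field U V" and p: "p \<in> U"
  shows "g p (curvature X Y Z p) (V p) = - g p (curvature X Y V p) (Z p)"
proof -
  have pM: "q \<in> topspace M" if "q \<in> U" for q
    using vector_field_openin[OF X] openin_subset that by blast
  define h where "h = (\<lambda>q. g q (Z q) (V q))"
  have h: "smooth_fun U h"
    unfolding h_def by (rule metric_smooth[OF Z V])
  have second: "F p (\<lambda>q. G q h)
      = (g p (cov F (cov G Z) p) (V p) + g p (cov G Z p) (cov F V p))
      + (g p (cov F Z p) (cov G V p) + g p (Z p) (cov F (cov G V) p))"
    if F: "vector_field U F" and G: "vector_field U G" for F G
  proof -
    note Fp = vector_field_tangent[OF F p]
    note GZ = cov_vector_field[OF G Z] and GV = cov_vector_field[OF G V]
    have 1: "smooth_fun U (\<lambda>q. g q (cov G Z q) (V q))" and 2: "smooth_fun U (\<lambda>q. g q (Z q) (cov G V q))"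
      by (rule metric_smooth[OF GZ V] metric_smooth[OF Z GV])+
    have "G q h = g q (cov G Z q) (V q) + g q (Z q) (cov G V q)" if "q \<in> U" for q
      unfolding h_def cov_def by (rule metric_compatible[OF Z V that vector_field_tangent[OF G that]])
    then have "F p (\<lambda>q. G q h) = F p (\<lambda>q. g q (cov G Z q) (V q) + g q (Z q) (cov G V q))"
      by (intro tangent_local[OF Fp smooth_nearI[OF vector_field_smooth_fun[OF G order_refl h] p]
            smooth_nearI[OF smooth_fun_add[OF 1 2] p] vector_field_openin[OF F] p])
    also have "\<dots> = F p (\<lambda>q. g q (cov G Z q) (V q)) + F p (\<lambda>q. g q (Z q) (cov G V q))"
      by (rule tangent_add[OF Fp smooth_nearI[OF 1 p] smooth_nearI[OF 2 p]])
    also have "F p (\<lambda>q. g q (cov G Z q) (V q)) = g p (cov F (cov G Z) p) (V p) + g p (cov G Z p) (cov F V p)"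
      unfolding cov_def[of F] by (rule metric_compatible[OF GZ V p Fp])
    also have "F p (\<lambda>q. g q (Z q) (cov G V q)) = g p (cov F Z p) (cov G V p) + g p (Z p) (cov F (cov G V) p)"
      unfolding cov_def[of F] by (rule metric_compatible[OF Z GV p Fp])
    finally show ?thesis .
  qed
  let ?L = "lie_bracket X Y"
  note LT = lie_bracket_tangent[OF X Y p]
  have t: "cov F (cov G H) p \<in> tangent_space p" "cov F G p \<in> tangent_space p" "cov ?L G p \<in> tangent_space p"
    if "vector_field U F" "vector_field U G" "vector_field U H" for F G H
    unfolding cov_def[of ?L]
    by (rule vector_field_tangent[OF cov_vector_field p] cov_vector_field conn_tangent[OF _ p LT] that)+
  have sym: "g p u v = g p v u" if "u \<in> tangent_space p" "v \<in> tangent_space p" for u v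
    by (rule metric_sym[OF pM[OF p] that])
  have cT: "cov X (cov Y H) p - cov Y (cov X H) p \<in> tangent_space p" if "vector_field U H" for H
    using t X Y that by (intro subspace_diff[OF subspace_tangent_space]) blast+
  have expand: "g p (curvature X Y H p) w
      = g p (cov X (cov Y H) p) w - g p (cov Y (cov X H) p) w - g p (cov ?L H p) w"
    if "vector_field U H" "w \<in> tangent_space p" for H w
    unfolding curvature_def
    using metric_diff_left[OF pM[OF p] cT[OF that(1)] t(3)[OF X that(1) X] that(2)]
      metric_diff_left[OF pM[OF p] t(1)[OF X Y that(1)] t(1)[OF Y X that(1)] that(2)] by simp
  have "X p (\<lambda>q. Y q h) - Y p (\<lambda>q. X q h) = ?L p h"
    using smooth_nearI[OF h p] by (simp add: lie_bracket_def)
  also have "\<dots> = g p (cov ?L Z p) (V p) + g p (Z p) (cov ?L V p)"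
    unfolding h_def cov_def by (rule metric_compatible[OF Z V p LT])
  finally show ?thesis
    unfolding second[OF X Y] second[OF Y X]
      expand[OF Z vector_field_tangent[OF V p]] expand[OF V vector_field_tangent[OF Z p]]
    using sym[OF vector_field_tangent[OF Z p]] t X Y V by simp
qed

section \<open>The curvature tensor at a point and its components\<close>

lemma curvature_expansion:
  assumes E: "orthonormal_frame W E" "p \<in> W"
    and F: "vector_field U X" "vector_field U Y" "vector_field U Z" "p \<in> U"
  shows "curvature X Y Z p = (\<Sum>a\<in>UNIV. \<Sum>b\<in>UNIV. \<Sum>c\<in>UNIV.
    (g p (X p) (E a p) * g p (Y p) (E b p) * g p (Z p) (E c p)) *\<^sub>R curvature (E a) (E b) (E c) p)"
proof -
  let ?V = "U \<inter> W"
  have V: "openin M ?V"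
    using orthonormal_frameD(1)[OF E(1)] vector_field_openin[OF F(1)] by (rule openin_Int[rotated])
  have pV: "p \<in> ?V" using E F by blast
  have E': "orthonormal_frame ?V E"
    by (rule orthonormal_frame_subset[OF E(1) _ V]) blast
  have vf: "vector_field ?V X" "vector_field ?V Y" "vector_field ?V Z" "vector_field ?V (E i)" for i
    using vector_field_subset[OF _ _ V] F orthonormal_frameD(2)[OF E'] by blast+
  have 1: "curvature X Y Z p = (\<Sum>a\<in>UNIV. g p (X p) (E a p) *\<^sub>R curvature (E a) Y Z p)"
    if "vector_field ?V X" "vector_field ?V Y" "vector_field ?V Z" for X Y Z
    using that
    by (intro tensorial_expansion[OF E' pV, where T = "\<lambda>X. curvature X Y Z p"]
        curvature_add1[where U = ?V] curvature_scale1[where U = ?V] curvature_cong1[where U = ?V] pV) assumption+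
  \<comment> \<open>The second slot is reduced to the first by skew symmetry.\<close>
  have 2: "curvature X Y Z p = (\<Sum>b\<in>UNIV. g p (Y p) (E b p) *\<^sub>R curvature X (E b) Z p)"
    if "vector_field ?V X" "vector_field ?V Y" "vector_field ?V Z" for X Y Z
  proof -
    have "curvature X Y Z p = - curvature Y X Z p"
      by (rule curvature_swap[OF that(2,1,3) pV])
    also have "curvature Y X Z p = (\<Sum>b\<in>UNIV. g p (Y p) (E b p) *\<^sub>R curvature (E b) X Z p)"
      by (rule 1[OF that(2,1,3)])
    finally show ?thesis
      by (simp only: curvature_swap[OF that(1) vf(4) that(3) pV] scaleR_minus_right sum_negf minus_minus)
  qed
  have 3: "curvature X Y Z p = (\<Sum>c\<in>UNIV. g p (Z p) (E c p) *\<^sub>R curvature X Y (E c) p)"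
    if "vector_field ?V X" "vector_field ?V Y" "vector_field ?V Z" for X Y Z
    using that
    by (intro tensorial_expansion[OF E' pV, where T = "\<lambda>Z. curvature X Y Z p"]
        curvature_add3[where U = ?V] curvature_scale3[where U = ?V] curvature_cong3[where U = ?V] pV) assumption+
  show ?thesis
    unfolding 1[OF vf(1-3)] 2[OF vf(4,2,3)] 3[OF vf(4,4,3)]
    by (simp only: scaleR_sum_right scaleR_scaleR mult.assoc)
qed

text \<open>By \<open>curvature_expansion\<close> every admissible choice of fields gives this same
  value, which involves only their values at \<open>p\<close>; this is the uniqueness behind the
  definite description.\<close>

lemma curv_expansion:
  assumes E: "orthonormal_frame U E" "p \<in> U"
    and T: "x \<in> tangent_space p" "y \<in> tangent_space p" "z \<in> tangent_space p"
  shows "curv p x y z = (\<Sum>a\<in>UNIV. \<Sum>b\<in>UNIV. \<Sum>c\<in>UNIV.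
    (g p x (E a p) * g p y (E b p) * g p z (E c p)) *\<^sub>R curvature (E a) (E b) (E c) p)"
    (is "_ = ?R")
  unfolding curv_def
proof (rule the_equality)
  note frame = orthonormal_frameD[OF E(1)]
  \<comment> \<open>An extension of \<open>v\<close> with constant coefficients in the frame, which
    witnesses existence.\<close>
  define C where "C v = (\<lambda>q. \<Sum>i\<in>UNIV. g p v (E i p) *\<^sub>R E i q)" for v
  have C: "vector_field U (C v)" for v
    unfolding C_def by (rule vector_field_sum[OF finite frame(1) smooth_fun_const[OF frame(1)] frame(2)])
  have Cp: "C v p = v" if "v \<in> tangent_space p" for v
    unfolding C_def using orthonormal_expansion[OF frame(3)[OF E(2)] frame(4)[OF E(2)] that] by metis
  show "\<exists>U X Y Z. p \<in> U \<and> vector_field U X \<and> vector_field U Y \<and> vector_field U Z \<and>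
        X p = x \<and> Y p = y \<and> Z p = z \<and> ?R = curvature X Y Z p"
  proof (intro exI conjI)
    show "?R = curvature (C x) (C y) (C z) p"
      by (simp only: curvature_expansion[OF E C C C E(2)] Cp T)
  qed (rule C Cp T E)+
  fix w assume "\<exists>U X Y Z. p \<in> U \<and> vector_field U X \<and> vector_field U Y \<and> vector_field U Z \<and>
        X p = x \<and> Y p = y \<and> Z p = z \<and> w = curvature X Y Z p"
  then obtain V X Y Z where "p \<in> V" "vector_field V X" "vector_field V Y" "vector_field V Z"
    "X p = x" "Y p = y" "Z p = z" "w = curvature X Y Z p"
    by (elim exE conjE)
  then show "w = ?R"
    by (simp only: curvature_expansion[OF E])
qed

context
  fixes U :: "'a set" and E :: "'n \<Rightarrow> 'a \<Rightarrow> 'a tvec" and p :: 'a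
  assumes E: "orthonormal_frame U E" and p: "p \<in> U"
begin

lemma frame_tangent: "E i p \<in> tangent_space p"
  using orthonormal_frameD(2)[OF E] p vector_field_tangent by blast

lemma Rc_eq: "Rc E p i j k l = g p (curvature (E i) (E j) (E k) p) (E l p)"
proof -
  note vf = orthonormal_frameD(2)[OF E]
  show ?thesis
    unfolding Rc_def
    by (simp only: curv_expansion[OF E p] frame_tangent curvature_expansion[OF E p vf vf vf p, symmetric])
qed

lemma algebraic_curvature_Rc: "algebraic_curvature (Rc E p)"
proof
  note vf = orthonormal_frameD(2)[OF E] and pM = orthonormal_frameD(4)[OF E p]
  note T = curvature_tangent[OF vf vf vf p]
  fix a b c d
  show "Rc E p b a c d = - Rc E p a b c d"
    unfolding Rc_eq curvature_swap[OF vf vf vf p, of a b c]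
    using metric_scale_left[OF pM T T frame_tangent, where c = "- 1"] by simp
  show "Rc E p a b d c = - Rc E p a b c d"
    unfolding Rc_eq by (rule curvature_skew[OF vf vf vf vf p])
  have "g p (curvature (E a) (E b) (E c) p + curvature (E b) (E c) (E a) p + curvature (E c) (E a) (E b) p) (E d p) = 0"
    unfolding curvature_bianchi[OF vf vf vf p]
    using metric_scale_left[OF pM T T frame_tangent, where c = 0] by (simp only: scaleR_zero_left mult_zero_left)
  then show "Rc E p a b c d + Rc E p b c a d + Rc E p c a b d = 0"
    unfolding Rc_eq by (simp only: metric_add_left[OF pM] T frame_tangent subspace_add[OF subspace_tangent_space])
qed

lemma ricci_frame: "ricci p (E i p) (E j p) = (\<Sum>a\<in>UNIV. Rc E p a i j a)"
  unfolding ricci_def Rc_def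
proof (rule trace_on_orthonormal)
  note vf = orthonormal_frameD(2)[OF E]
  show e: "orthonormal_basis p (\<lambda>i. E i p)" "p \<in> topspace M"
    using orthonormal_frameD(3,4)[OF E p] .
  have G: "curv p (E a p) (E i p) (E j p) = curvature (E a) (E i) (E j) p" for a
    by (simp only: curv_expansion[OF E p] frame_tangent curvature_expansion[OF E p vf vf vf p, symmetric])
  show "curv p (E a p) (E i p) (E j p) \<in> tangent_space p" for a
    unfolding G by (rule curvature_tangent[OF vf vf vf p])
  show "curv p x (E i p) (E j p) = (\<Sum>a\<in>UNIV. g p x (E a p) *\<^sub>R curv p (E a p) (E i p) (E j p))"
    if x: "x \<in> tangent_space p" for x
    unfolding curv_expansion[OF E p x frame_tangent frame_tangent]
      curv_expansion[OF E p frame_tangent frame_tangent frame_tangent]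
      orthonormal_basis_inner[OF e(1)]
    by (simp add: scaleR_sum_right if_distrib[of "\<lambda>x. x * _"] if_distrib[of "\<lambda>x. _ * x"]
        if_distrib[of "\<lambda>x. x *\<^sub>R _"] cong: if_cong)
qed

end

text \<open>The bridge to the algebra: the Einstein condition on frame vectors identifies the
  constant \<open>l\<close> with \<tau>/n.\<close>

lemma einstein_curvature_Rc:
  assumes "einstein" and E: "orthonormal_frame U E" and p: "p \<in> U"
  shows "einstein_curvature (Rc E p) (scal p / real CARD('n))"
proof -
  interpret algebraic_curvature "Rc E p"
    by (rule algebraic_curvature_Rc[OF E p])
  show ?thesis
  proof
    fix i j
    have "ricci p (E i p) (E j p) = scal p / real CARD('n) * g p (E i p) (E j p)"
      using assms(1) frame_tangent[OF E p] orthonormal_frameD(4)[OF E p] unfolding einstein_def by blast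
    then show "(\<Sum>a\<in>UNIV. Rc E p a i j a) = (if i = j then scal p / real CARD('n) else 0)"
      unfolding ricci_frame[OF E p] using orthonormal_basis_inner[OF orthonormal_frameD(3)[OF E p]] by simp
  qed
qed

end

theorem theoremA:
  fixes M :: "'a topology"
    and A :: "('a, 5) chart set"
    and g :: "'a \<Rightarrow> 'a tvec \<Rightarrow> 'a tvec \<Rightarrow> real"
    and nabla :: "'a \<Rightarrow> 'a tvec \<Rightarrow> ('a \<Rightarrow> 'a tvec) \<Rightarrow> 'a tvec"
  assumes "levi_civita_manifold M A g nabla"
  shows
    "(levi_civita_manifold.einstein M A g nabla \<longrightarrow>
       (\<forall>U E p i j. riemannian_manifold.orthonormal_frame M A g U E \<and> p \<in> U \<longrightarrow>
          2 * levi_civita_manifold.scal M A g nabla p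
              * levi_civita_manifold.R_bar M A g nabla E p i j
            + 4 * levi_civita_manifold.R_check M A g nabla E p i j
            + 4 * levi_civita_manifold.R_hat M A g nabla E p i j
            - 8 * levi_civita_manifold.R_ring M A g nabla E p i j
          = (levi_civita_manifold.scal M A g nabla p / 5
                * levi_civita_manifold.R_norm_sq M A g nabla E p
              + levi_civita_manifold.scal M A g nabla p ^ 3 / 25) * g p (E i p) (E j p)))
     \<and>
     (levi_civita_manifold.super_einstein M A g nabla \<longrightarrow>
       (\<forall>U E p i j. riemannian_manifold.orthonormal_frame M A g U E \<and> p \<in> U \<longrightarrow>
          4 * levi_civita_manifold.R_ring M A g nabla E p i j
            - 2 * levi_civita_manifold.R_hat M A g nabla E p i j
          = (9 / 50 * levi_civita_manifold.scal M A g nabla p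
                * levi_civita_manifold.R_norm_sq M A g nabla E p
              - levi_civita_manifold.scal M A g nabla p ^ 3 / 50) * g p (E i p) (E j p)))"
proof (intro conjI impI allI)
  interpret levi_civita_manifold M A g nabla by fact
  have a: "2 * scal p * R_bar E p i j + 4 * R_check E p i j + 4 * R_hat E p i j - 8 * R_ring E p i j
      = (scal p / 5 * R_norm_sq E p + scal p ^ 3 / 25) * g p (E i p) (E j p)"
    if "einstein" "orthonormal_frame U E" "p \<in> U" for U E p i j
  proof -
    interpret einstein_curvature "Rc E p" "scal p / 5"
      using einstein_curvature_Rc[OF that] by simp
    have "R_bar E p i j = bar i j" "R_check E p i j = check i j" "R_hat E p i j = hat i j"
      "R_ring E p i j = ring i j" "R_norm_sq E p = nsq"
      by (simp_all only: R_bar_def bar_def R_check_def check_def R_hat_def hat_def R_ring_def ring_def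
          R_norm_sq_def nsq_def)
    then show ?thesis
      using curvature_identity[of i j] orthonormal_basis_inner[OF orthonormal_frameD(3)[OF that(2,3)], of i j]
      by (simp add: power3_eq_cube)
  qed
  fix U E p i j
  show "2 * scal p * R_bar E p i j + 4 * R_check E p i j + 4 * R_hat E p i j - 8 * R_ring E p i j
      = (scal p / 5 * R_norm_sq E p + scal p ^ 3 / 25) * g p (E i p) (E j p)"
    if "einstein" "orthonormal_frame U E \<and> p \<in> U"
    using a that by blast
  show "4 * R_ring E p i j - 2 * R_hat E p i j
      = (9 / 50 * scal p * R_norm_sq E p - scal p ^ 3 / 50) * g p (E i p) (E j p)"
    if s: "super_einstein" and F: "orthonormal_frame U E \<and> p \<in> U"
  proof -
    have e: "einstein" and E: "orthonormal_frame U E" and p: "p \<in> U"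
      using s F by (simp_all add: super_einstein_def)
    interpret einstein_curvature "Rc E p" "scal p / 5"
      using einstein_curvature_Rc[OF e E p] by simp
    have bar: "R_bar E p u v = R_norm_sq E p / 5 * g p (E u p) (E v p)" for u v
      using s F unfolding super_einstein_def by simp
    have "bar u v = (if u = v then R_norm_sq E p / 5 else 0)" for u v
    proof -
      have "bar u v = R_norm_sq E p / 5 * g p (E u p) (E v p)"
        using bar[of u v] by (simp only: R_bar_def bar_def)
      then show ?thesis
        using orthonormal_basis_inner[OF orthonormal_frameD(3)[OF E p], of u v]
        by (simp split: if_splits)
    qed
    then have "check i j = (if i = j then R_norm_sq E p / 5 * (scal p / 5) else 0)"
      by (rule check_of_scalar_bar)
    then have check: "R_check E p i j = R_norm_sq E p * scal p / 25 * g p (E i p) (E j p)"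
      unfolding R_check_def check_def orthonormal_basis_inner[OF orthonormal_frameD(3)[OF E p]]
      by (simp split: if_splits)
    \<comment> \<open>This is (a) with \<open>R_bar\<close> and \<open>R_check\<close> replaced by
      N/5 and N s/25 times the metric. The coefficient of \<open>s * N\<close> is 1/5 - 2/5 - 4/25 =
      -9/25; division by -2 gives 9/50 and -1/50.\<close>
    have "4 * r - 2 * h = (9 / 50 * s * N - s ^ 3 / 50) * G"
      if "2 * s * (N / 5 * G) + 4 * (N * s / 25 * G) + 4 * h - 8 * r = (s / 5 * N + s ^ 3 / 25) * G"
      for r h s N G :: real
      using that by (simp add: field_simps)
    then show ?thesis
      using a[OF e E p, of i j] unfolding bar[of i j] check by blast
  qed
qed

end
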